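(* Let $G$ be a finite group, $x\in G$, and $G'=[G,G]$. Consider the crossed module $(\mathrm{id}\colon G'\to G')$, with $G'$ acting on itself by conjugation, and define, for $L,M\in G'$, $\Phi^x=(\psi^x,\phi^x)$ by $$\phi^x(L,M)=[Mx^{-1},Lx^{-1}]=Mx^{-1}LM^{-1}xL^{-1},\qquad \psi^x(L,M)=[L,M][ML^{-1},x]=LML^{-1}L^{-1}xLM^{-1}x^{-1}.$$ Then $\Phi^x$ is an unframed Reidemeister pair for this crossed module. Moreover, if $K$ is an oriented knot in $S^3$ and $L_K$ is the associated string knot, then for every $g\in G'$, $$\langle 1_{G'}|I_{\Phi^x}(L_K)|g\rangle=f_E^K(g),$$ where $f_E^K(g)=\#\{f\in\mathrm{Hom}(\pi_1(C_K),G): f(m_p)=x,\ f(l_p)=g\}$ is the coefficient of $g$ in the Eisermann invariant $E(K)=\sum_{f\colon\pi_1(C_K)\to G,\ f(m_p)=x}f(l_p)$. (Here the left-hand side, a multiple of the unique morphism $1_{G'}\to g$, is identified with its integer coefficient.)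
   Context: $[a,b]=aba^{-1}b^{-1}$. Note $\phi^x,\psi^x$ take values in $G'$ although $x$ need not lie in $G'$. For a crossed module $(\mu\colon P\to H,\cdot)$ (group morphism $\mu$ with left action of $H$ on $P$ by automorphisms, $\mu(g\cdot e)=g\mu(e)g^{-1}$, $\mu(e)\cdot f=efe^{-1}$), functions $\psi,\phi\colon H\times H\to P$ form an unframed Reidemeister pair if for all $X,Y,T\in H$: (R1) $\psi(X,X)=1$; (R2) $\phi(X,Y)\psi(X,Z)=1$, where $Z=X^{-1}\mu(\phi(X,Y))^{-1}YX$; (R3) $\phi(Y,X)(Y\cdot\phi(T,Z))\phi(T,Y)=(X\cdot\phi(T,Y))\phi(T,X)(T\cdot\phi(V,W))$, where $Z=Y^{-1}\mu(\phi(Y,X))^{-1}XY$, $V=T^{-1}\mu(\phi(T,Y))^{-1}YT$, $W=T^{-1}\mu(\phi(T,X))^{-1}XT$. Diagrams are sliced: horizontal strips, each containing vertical lines and at most one cup, cap, or crossing $X_+$ (positive) or $X_-$ (negative). In $X_+$ both strands point down, the over strand runs from top right to bottom left and the under strand from top left to bottom right. In $X_-$ both strands point down, the over strand runs from top left to bottom right and the under strand from top right to bottom left. A Reidemeister colouring $F$ ($H$ finite) assigns elements of $H$ to arcs (extending prescribed labels at the end points) and elements of $P$ to crossings so that: at an $X_+$ with over arc $X$, bottom-right under arc $Y$, top-left under arc $Z$, the crossing carries $\psi(X,Y)$ and $Z=\mu(\psi(X,Y))^{-1}XYX^{-1}$; at an $X_-$ with over arc $X$, bottom-left under arc $Y$,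 top-right under arc $Z$, the crossing carries $\phi(X,Y)$ and $Z=X^{-1}\mu(\phi(X,Y))^{-1}YX$. The associated monoidal category has objects the elements of $H$, morphisms $U\xrightarrow{e}V$ with $e\in P$, $\mu(e)U=V$, composition $U\xrightarrow{e}V\xrightarrow{f}W=U\xrightarrow{fe}W$, tensor product $(U\xrightarrow{e}V)\otimes(U'\xrightarrow{e'}V')=(UU'\xrightarrow{(V\cdot e')e}VV')$. The evaluation $e(F)$ is obtained by tensoring horizontally and composing vertically (top to bottom), where $X_+$ gives $ZX\xrightarrow{\psi(X,Y)}XY$, $X_-$ gives $XZ\xrightarrow{\phi(X,Y)}YX$, vertical strands coloured $X$ give identities of $X$ (downwards) or $X^{-1}$ (upwards), cups and caps give morphisms with element $1_P$. For a string knot diagram, $\langle a|I_\Phi|b\rangle=\sum_Fe(F)\in\mathbb{N}[\mathrm{Hom}(a,b)]$, over all colourings $F$ with top end labelled $a$ and bottom end labelled $b$. String knot: a tangle whose underlying manifold is an interval, with boundary $\{0\}\times\{0\}\times\{\pm1\}$, oriented downwards; $L_K$ is the string knot, unique up to isotopy, whose closure is $K$. $C_K$ is the complement of an open regular neighbourhood of $K$ in $S^3$; $p\in K$ is a base point, $m_p$ the meridian at $p$ oriented by the right hand rule, and $l_p$ the longitude (parallel to $K$, with zero linking number with $K$) commuting with $m_p$. $E(K)$ does not depend on $p$. Explicitly, take $p$ at the top end of a diagram of $L_K$, and use Wirtinger generators $g_a$ of $\pi_1(C_K)$ ($a$ the arcs) with relation $g_Zg_X=g_Xg_Y$ at each crossing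 $X_+$ with over arc $X$, bottom-right under arc $Y$ and top-left under arc $Z$, and relation $g_Xg_Z=g_Yg_X$ at each crossing $X_-$ with over arc $X$, bottom-left under arc $Y$ and top-right under arc $Z$. If $a_1,\dots,a_n$ are the arcs in the order met from the top, $a_{j_i}$ is the over arc and $\theta_i$ the sign of the crossing separating $a_i$ from $a_{i+1}$, then $m_p=g_{a_1}$ and $l_p=\prod_{i=1}^{n-1}g_{a_i}^{-\theta_i}g_{a_{j_i}}^{\theta_i}$ (ordered product). *)

theory Defs
  imports "HOL-Library.Multiset" "HOL-Algebra.Bij" "HOL-Algebra.Generated_Groups"
begin

section \<open>Crossed modules and unframed Reidemeister pairs\<close>

text \<open>A left action by automorphisms is a group morphism into the automorphism group; functions in
  \<^const>\<open>AutoGroup\<close> are extensional on the carrier.\<close>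

locale crossed_module = P: group P + H: group H
  for P :: "('p, 'c) monoid_scheme" (structure) and H :: "('h, 'd) monoid_scheme" (structure) +
  fixes \<mu> :: "'p \<Rightarrow> 'h" and act :: "'h \<Rightarrow> 'p \<Rightarrow> 'p"
  assumes boundary_hom: "\<mu> \<in> hom P H"
    and action_hom: "act \<in> hom H (AutoGroup P)"
    and equivariant: "\<lbrakk>g \<in> carrier H; e \<in> carrier P\<rbrakk> \<Longrightarrow>
      \<mu> (act g e) = g \<otimes>\<^bsub>H\<^esub> \<mu> e \<otimes>\<^bsub>H\<^esub> inv\<^bsub>H\<^esub> g"
    and peiffer: "\<lbrakk>e \<in> carrier P; f \<in> carrier P\<rbrakk> \<Longrightarrow>
      act (\<mu> e) f = e \<otimes>\<^bsub>P\<^esub> f \<otimes>\<^bsub>P\<^esub> inv\<^bsub>P\<^esub> e"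

locale unframed_reidemeister_pair = crossed_module P H \<mu> act
  for P :: "('p, 'c) monoid_scheme" (structure) and H :: "('h, 'd) monoid_scheme" (structure)
    and \<mu> :: "'p \<Rightarrow> 'h" and act :: "'h \<Rightarrow> 'p \<Rightarrow> 'p" +
  fixes \<psi> \<phi> :: "'h \<Rightarrow> 'h \<Rightarrow> 'p"
  assumes \<psi>_closed: "\<lbrakk>X \<in> carrier H; Y \<in> carrier H\<rbrakk> \<Longrightarrow> \<psi> X Y \<in> carrier P"
    and \<phi>_closed: "\<lbrakk>X \<in> carrier H; Y \<in> carrier H\<rbrakk> \<Longrightarrow> \<phi> X Y \<in> carrier P"
    and R1: "X \<in> carrier H \<Longrightarrow> \<psi> X X = \<one>\<^bsub>P\<^esub>"
    and R2: "\<lbrakk>X \<in> carrier H; Y \<in> carrier H;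
        Z = inv\<^bsub>H\<^esub> X \<otimes>\<^bsub>H\<^esub> inv\<^bsub>H\<^esub> (\<mu> (\<phi> X Y)) \<otimes>\<^bsub>H\<^esub> Y \<otimes>\<^bsub>H\<^esub> X\<rbrakk> \<Longrightarrow>
      \<phi> X Y \<otimes>\<^bsub>P\<^esub> \<psi> X Z = \<one>\<^bsub>P\<^esub>"
    and R3: "\<lbrakk>X \<in> carrier H; Y \<in> carrier H; T \<in> carrier H;
        Z = inv\<^bsub>H\<^esub> Y \<otimes>\<^bsub>H\<^esub> inv\<^bsub>H\<^esub> (\<mu> (\<phi> Y X)) \<otimes>\<^bsub>H\<^esub> X \<otimes>\<^bsub>H\<^esub> Y;
        V = inv\<^bsub>H\<^esub> T \<otimes>\<^bsub>H\<^esub> inv\<^bsub>H\<^esub> (\<mu> (\<phi> T Y)) \<otimes>\<^bsub>H\<^esub> Y \<otimes>\<^bsub>H\<^esub> T;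
        W = inv\<^bsub>H\<^esub> T \<otimes>\<^bsub>H\<^esub> inv\<^bsub>H\<^esub> (\<mu> (\<phi> T X)) \<otimes>\<^bsub>H\<^esub> X \<otimes>\<^bsub>H\<^esub> T\<rbrakk> \<Longrightarrow>
      \<phi> Y X \<otimes>\<^bsub>P\<^esub> act Y (\<phi> T Z) \<otimes>\<^bsub>P\<^esub> \<phi> T Y =
      act X (\<phi> T Y) \<otimes>\<^bsub>P\<^esub> \<phi> T X \<otimes>\<^bsub>P\<^esub> act T (\<phi> V W)"

text \<open>The monoidal category of a crossed module: \<open>Mor U e V\<close> is the morphism \<open>U \<rightarrow> V\<close> given
  by \<open>e\<close>. In \<open>mor_comp P f g\<close> the morphism \<open>f\<close> comes first.\<close>

datatype ('h, 'p) mor = Mor (source: 'h) (elt: 'p) (target: 'h)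

definition mor_set ::
  "('p, 'c) monoid_scheme \<Rightarrow> ('h, 'd) monoid_scheme \<Rightarrow> ('p \<Rightarrow> 'h) \<Rightarrow> 'h \<Rightarrow> 'h \<Rightarrow> ('h, 'p) mor set"
  where "mor_set P H \<mu> U V =
    {Mor U e V | e. U \<in> carrier H \<and> V \<in> carrier H \<and> e \<in> carrier P \<and> \<mu> e \<otimes>\<^bsub>H\<^esub> U = V}"

definition mor_id :: "('p, 'c) monoid_scheme \<Rightarrow> 'h \<Rightarrow> ('h, 'p) mor"
  where "mor_id P U = Mor U \<one>\<^bsub>P\<^esub> U"

definition mor_comp ::
  "('p, 'c) monoid_scheme \<Rightarrow> ('h, 'p) mor \<Rightarrow> ('h, 'p) mor \<Rightarrow> ('h, 'p) mor"
  where "mor_comp P f g = Mor (source f) (elt g \<otimes>\<^bsub>P\<^esub> elt f) (target g)"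

definition mor_tensor ::
  "('p, 'c) monoid_scheme \<Rightarrow> ('h, 'd) monoid_scheme \<Rightarrow> ('h \<Rightarrow> 'p \<Rightarrow> 'p) \<Rightarrow>
    ('h, 'p) mor \<Rightarrow> ('h, 'p) mor \<Rightarrow> ('h, 'p) mor"
  where "mor_tensor P H act f g =
    Mor (source f \<otimes>\<^bsub>H\<^esub> source g) (act (target f) (elt g) \<otimes>\<^bsub>P\<^esub> elt f)
        (target f \<otimes>\<^bsub>H\<^esub> target g)"

section \<open>Sliced string knot diagrams\<close>

text \<open>Diagrams are read from top to bottom and from left to right. \<open>Cup d\<close> joins two adjacent
  strands at the top of a strip, \<open>Cap d\<close> joins two adjacent strands at its bottom; \<open>d\<close> is the
  orientation of the left-hand one. A strip consists of vertical lines with the given orientations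
  to the left and to the right of at most one elementary piece.\<close>

datatype dir = Down | Up

primrec opposite :: "dir \<Rightarrow> dir" where
  "opposite Down = Up"
| "opposite Up = Down"

datatype piece = NoPiece | Cup dir | Cap dir | XPos | XNeg

primrec piece_top :: "piece \<Rightarrow> dir list" where
  "piece_top NoPiece = []"
| "piece_top (Cup d) = [d, opposite d]"
| "piece_top (Cap d) = []"
| "piece_top XPos = [Down, Down]"
| "piece_top XNeg = [Down, Down]"

primrec piece_bot :: "piece \<Rightarrow> dir list" where
  "piece_bot NoPiece = []"
| "piece_bot (Cup d) = []"
| "piece_bot (Cap d) = [d, opposite d]"
| "piece_bot XPos = [Down, Down]"
| "piece_bot XNeg = [Down, Down]"

datatype strip = Strip (lefts: "dir list") (mid: piece) (rights: "dir list")

definition strip_top :: "strip \<Rightarrow> dir list"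
  where "strip_top s = lefts s @ piece_top (mid s) @ rights s"

definition strip_bot :: "strip \<Rightarrow> dir list"
  where "strip_bot s = lefts s @ piece_bot (mid s) @ rights s"

type_synonym diagram = "strip list"

fun is_tangle :: "dir list \<Rightarrow> diagram \<Rightarrow> dir list \<Rightarrow> bool" where
  "is_tangle u [] w \<longleftrightarrow> u = w"
| "is_tangle u (s # D) w \<longleftrightarrow> strip_top s = u \<and> is_tangle (strip_bot s) D w"

text \<open>\<open>boundary D t\<close> is the row of oriented end points at level \<open>t\<close>: strip \<open>t\<close> lies between the
  levels \<open>t\<close> and \<open>t + 1\<close>, level \<open>0\<close> is the top. The pair \<open>(t, j)\<close> is the \<open>j\<close>-th point of
  level \<open>t\<close>.\<close>

definition boundary :: "diagram \<Rightarrow> nat \<Rightarrow> dir list"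
  where "boundary D t = ([Down] # map strip_bot D) ! t"

type_synonym point = "nat \<times> nat"

definition points :: "diagram \<Rightarrow> point set"
  where "points D = {(t, j). t \<le> length D \<and> j < length (boundary D t)}"

definition top_point :: "diagram \<Rightarrow> point"
  where "top_point D = (0, 0)"

definition bot_point :: "diagram \<Rightarrow> point"
  where "bot_point D = (length D, 0)"

definition crossings :: "diagram \<Rightarrow> nat set"
  where "crossings D = {t. t < length D \<and> mid (D ! t) \<in> {XPos, XNeg}}"

text \<open>The three points below are only meaningful for a crossing in strip \<open>t\<close>. Both strands of a
  crossing point down, so the under strand enters at the top and leaves at the bottom.\<close>

definition over_point :: "diagram \<Rightarrow> nat \<Rightarrow> point"
  where "over_point D t = (let n = length (lefts (D ! t)) in
    if mid (D ! t) = XPos then (t, n + 1) else (t, n))"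

definition under_in_point :: "diagram \<Rightarrow> nat \<Rightarrow> point"
  where "under_in_point D t = (let n = length (lefts (D ! t)) in
    if mid (D ! t) = XPos then (t, n) else (t, n + 1))"

definition under_out_point :: "diagram \<Rightarrow> nat \<Rightarrow> point"
  where "under_out_point D t = (let n = length (lefts (D ! t)) in
    if mid (D ! t) = XPos then (t + 1, n + 1) else (t + 1, n))"

text \<open>Pairs of points that are joined inside strip \<open>t\<close>, first without the under strands.\<close>

definition over_links :: "diagram \<Rightarrow> nat \<Rightarrow> (point \<times> point) set"
  where "over_links D t =
    (let l = length (lefts (D ! t)); r = length (rights (D ! t)); p = mid (D ! t) in
      {((t, j), (t + 1, j)) | j. j < l} \<union>
      {((t, l + length (piece_top p) + j), (t + 1, l + length (piece_bot p) + j)) | j. j < r} \<union>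
      (case p of
        NoPiece \<Rightarrow> {}
      | Cup d \<Rightarrow> {((t, l), (t, l + 1))}
      | Cap d \<Rightarrow> {((t + 1, l), (t + 1, l + 1))}
      | XPos \<Rightarrow> {((t, l + 1), (t + 1, l))}
      | XNeg \<Rightarrow> {((t, l), (t + 1, l + 1))}))"

definition all_links :: "diagram \<Rightarrow> (point \<times> point) set"
  where "all_links D = (\<Union>t<length D. over_links D t) \<union>
    {(under_in_point D t, under_out_point D t) | t. t \<in> crossings D}"

definition arc_rel :: "diagram \<Rightarrow> (point \<times> point) set"
  where "arc_rel D = (let R = \<Union>t<length D. over_links D t in
    {(p, q) \<in> (R \<union> R\<inverse>)\<^sup>*. p \<in> points D \<and> q \<in> points D})"

type_synonym arc = "point set"

definition arcs :: "diagram \<Rightarrow> arc set"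
  where "arcs D = points D // arc_rel D"

definition arc_of :: "diagram \<Rightarrow> point \<Rightarrow> arc"
  where "arc_of D p = arc_rel D `` {p}"

definition over_arc :: "diagram \<Rightarrow> nat \<Rightarrow> arc"
  where "over_arc D t = arc_of D (over_point D t)"

definition under_in_arc :: "diagram \<Rightarrow> nat \<Rightarrow> arc"
  where "under_in_arc D t = arc_of D (under_in_point D t)"

definition under_out_arc :: "diagram \<Rightarrow> nat \<Rightarrow> arc"
  where "under_out_arc D t = arc_of D (under_out_point D t)"

definition crossing_sign :: "diagram \<Rightarrow> nat \<Rightarrow> int"
  where "crossing_sign D t = (if mid (D ! t) = XPos then 1 else - 1)"

text \<open>The underlying one-dimensional manifold is an interval precisely when there is one end point
  at the top, one at the bottom, and no further (closed) component.\<close>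

definition string_knot_diagram :: "diagram \<Rightarrow> bool"
  where "string_knot_diagram D \<longleftrightarrow> is_tangle [Down] D [Down] \<and>
    (\<forall>p \<in> points D. \<forall>q \<in> points D. (p, q) \<in> (all_links D \<union> (all_links D)\<inverse>)\<^sup>*)"

section \<open>Reidemeister colourings and their evaluation\<close>

text \<open>A colouring is a pair of extensional functions, on the arcs and on the crossings. Below, \<open>Z\<close>
  is the upper and \<open>Y\<close> the lower under arc of the crossing.\<close>

type_synonym ('h, 'p) colouring = "(arc \<Rightarrow> 'h) \<times> (nat \<Rightarrow> 'p)"

definition colourings ::
  "('p, 'c) monoid_scheme \<Rightarrow> ('h, 'd) monoid_scheme \<Rightarrow> ('p \<Rightarrow> 'h) \<Rightarrow>
    ('h \<Rightarrow> 'h \<Rightarrow> 'p) \<Rightarrow> ('h \<Rightarrow> 'h \<Rightarrow> 'p) \<Rightarrow> diagram \<Rightarrow> 'h \<Rightarrow> 'h \<Rightarrow> ('h, 'p) colouring set"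
  where "colourings P H \<mu> \<psi> \<phi> D a b = {(c, d).
    c \<in> arcs D \<rightarrow>\<^sub>E carrier H \<and> d \<in> crossings D \<rightarrow>\<^sub>E carrier P \<and>
    c (arc_of D (top_point D)) = a \<and> c (arc_of D (bot_point D)) = b \<and>
    (\<forall>t \<in> crossings D.
      let X = c (over_arc D t); Y = c (under_out_arc D t); Z = c (under_in_arc D t) in
      if mid (D ! t) = XPos
      then d t = \<psi> X Y \<and> Z = inv\<^bsub>H\<^esub> (\<mu> (\<psi> X Y)) \<otimes>\<^bsub>H\<^esub> X \<otimes>\<^bsub>H\<^esub> Y \<otimes>\<^bsub>H\<^esub> inv\<^bsub>H\<^esub> X
      else d t = \<phi> X Y \<and> Z = inv\<^bsub>H\<^esub> X \<otimes>\<^bsub>H\<^esub> inv\<^bsub>H\<^esub> (\<mu> (\<phi> X Y)) \<otimes>\<^bsub>H\<^esub> Y \<otimes>\<^bsub>H\<^esub> X)}"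

definition point_obj ::
  "('h, 'd) monoid_scheme \<Rightarrow> diagram \<Rightarrow> (arc \<Rightarrow> 'h) \<Rightarrow> nat \<Rightarrow> nat \<Rightarrow> 'h"
  where "point_obj H D c t j =
    (case boundary D t ! j of
      Down \<Rightarrow> c (arc_of D (t, j))
    | Up \<Rightarrow> inv\<^bsub>H\<^esub> (c (arc_of D (t, j))))"

definition piece_eval ::
  "('p, 'c) monoid_scheme \<Rightarrow> ('h, 'd) monoid_scheme \<Rightarrow> diagram \<Rightarrow> ('h, 'p) colouring \<Rightarrow>
    nat \<Rightarrow> ('h, 'p) mor list"
  where "piece_eval P H D = (\<lambda>(c, d) t.
    let l = length (lefts (D ! t));
        above = point_obj H D c t l \<otimes>\<^bsub>H\<^esub> point_obj H D c t (l + 1);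
        below = point_obj H D c (t + 1) l \<otimes>\<^bsub>H\<^esub> point_obj H D c (t + 1) (l + 1)
    in case mid (D ! t) of
        NoPiece \<Rightarrow> []
      | Cup _ \<Rightarrow> [Mor above \<one>\<^bsub>P\<^esub> \<one>\<^bsub>H\<^esub>]
      | Cap _ \<Rightarrow> [Mor \<one>\<^bsub>H\<^esub> \<one>\<^bsub>P\<^esub> below]
      | XPos \<Rightarrow> [Mor above (d t) below]
      | XNeg \<Rightarrow> [Mor above (d t) below])"

definition strip_eval ::
  "('p, 'c) monoid_scheme \<Rightarrow> ('h, 'd) monoid_scheme \<Rightarrow> ('h \<Rightarrow> 'p \<Rightarrow> 'p) \<Rightarrow> diagram \<Rightarrow>
    ('h, 'p) colouring \<Rightarrow> nat \<Rightarrow> ('h, 'p) mor"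
  where "strip_eval P H act D F t =
    (let l = length (lefts (D ! t)); r = length (rights (D ! t));
         k = length (piece_top (mid (D ! t)));
         vertical = (\<lambda>j. mor_id P (point_obj H D (fst F) t j))
     in foldr (mor_tensor P H act)
          (map vertical [0..<l] @ piece_eval P H D F t @ map vertical [l + k..<l + k + r])
          (mor_id P \<one>\<^bsub>H\<^esub>))"

definition evaluation ::
  "('p, 'c) monoid_scheme \<Rightarrow> ('h, 'd) monoid_scheme \<Rightarrow> ('h \<Rightarrow> 'p \<Rightarrow> 'p) \<Rightarrow> diagram \<Rightarrow>
    ('h, 'p) colouring \<Rightarrow> ('h, 'p) mor"
  where "evaluation P H act D F =
    foldl (mor_comp P) (mor_id P (point_obj H D (fst F) 0 0))
      (map (strip_eval P H act D F) [0..<length D])"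

text \<open>An element of \<open>\<nat>[S]\<close>, i.e. a formal sum of elements of \<open>S\<close> with coefficients in \<open>\<nat>\<close>, is
  represented as a multiset.\<close>

definition state_sum ::
  "('p, 'c) monoid_scheme \<Rightarrow> ('h, 'd) monoid_scheme \<Rightarrow> ('p \<Rightarrow> 'h) \<Rightarrow> ('h \<Rightarrow> 'p \<Rightarrow> 'p) \<Rightarrow>
    ('h \<Rightarrow> 'h \<Rightarrow> 'p) \<Rightarrow> ('h \<Rightarrow> 'h \<Rightarrow> 'p) \<Rightarrow> diagram \<Rightarrow> 'h \<Rightarrow> 'h \<Rightarrow> ('h, 'p) mor multiset"
  where "state_sum P H \<mu> act \<psi> \<phi> D a b =
    (\<Sum>F \<in> colourings P H \<mu> \<psi> \<phi> D a b. {# evaluation P H act D F #})"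

section \<open>The knot group and the Eisermann invariant\<close>

text \<open>Group presentations: \<open>(a, True)\<close> is the generator \<open>a\<close>, \<open>(a, False)\<close> its inverse.\<close>

type_synonym 'g word = "('g \<times> bool) list"

inductive word_equiv :: "'g set \<Rightarrow> ('g word \<times> 'g word) set \<Rightarrow> 'g word \<Rightarrow> 'g word \<Rightarrow> bool"
  for S R where
  refl: "w \<in> lists (S \<times> UNIV) \<Longrightarrow> word_equiv S R w w"
| sym: "word_equiv S R v w \<Longrightarrow> word_equiv S R w v"
| trans: "word_equiv S R u v \<Longrightarrow> word_equiv S R v w \<Longrightarrow> word_equiv S R u w"
| cancel: "\<lbrakk>u \<in> lists (S \<times> UNIV); v \<in> lists (S \<times> UNIV); a \<in> S\<rbrakk> \<Longrightarrow>
    word_equiv S R (u @ [(a, b), (a, \<not> b)] @ v) (u @ v)"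
| relation: "\<lbrakk>u \<in> lists (S \<times> UNIV); v \<in> lists (S \<times> UNIV); (r, s) \<in> R;
    r \<in> lists (S \<times> UNIV); s \<in> lists (S \<times> UNIV)\<rbrakk> \<Longrightarrow>
    word_equiv S R (u @ r @ v) (u @ s @ v)"

definition word_class :: "'g set \<Rightarrow> ('g word \<times> 'g word) set \<Rightarrow> 'g word \<Rightarrow> 'g word set"
  where "word_class S R w = {v. word_equiv S R w v}"

definition presented_group :: "'g set \<Rightarrow> ('g word \<times> 'g word) set \<Rightarrow> 'g word set monoid"
  where "presented_group S R =
    \<lparr>carrier = word_class S R ` lists (S \<times> UNIV),
     mult = (\<lambda>A B. \<Union>u \<in> A. \<Union>v \<in> B. word_class S R (u @ v)),
     one = word_class S R []\<rparr>"

text \<open>The fundamental group of the complement of the closure of a string knot diagram, in its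
  Wirtinger presentation, with the base point on the knot at the top end of the diagram.\<close>

definition wirtinger_relations :: "diagram \<Rightarrow> (arc word \<times> arc word) set"
  where "wirtinger_relations D =
    {let X = over_arc D t; Y = under_out_arc D t; Z = under_in_arc D t in
      if mid (D ! t) = XPos then ([(Z, True), (X, True)], [(X, True), (Y, True)])
      else ([(X, True), (Z, True)], [(Y, True), (X, True)]) | t. t \<in> crossings D}"

definition knot_group :: "diagram \<Rightarrow> arc word set monoid"
  where "knot_group D = presented_group (arcs D) (wirtinger_relations D)"

definition wirtinger_gen :: "diagram \<Rightarrow> arc \<Rightarrow> arc word set"
  where "wirtinger_gen D a = word_class (arcs D) (wirtinger_relations D) [(a, True)]"

text \<open>\<open>nth_arc D i\<close> and \<open>nth_under D i\<close> are the \<open>i\<close>-th arc met from the top and the crossing that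
  separates it from the next arc, counting from \<open>0\<close>.\<close>

definition under_after :: "diagram \<Rightarrow> arc \<Rightarrow> nat"
  where "under_after D a = (THE t. t \<in> crossings D \<and> under_in_arc D t = a)"

primrec nth_arc :: "diagram \<Rightarrow> nat \<Rightarrow> arc" where
  "nth_arc D 0 = arc_of D (top_point D)"
| "nth_arc D (Suc i) = under_out_arc D (under_after D (nth_arc D i))"

definition nth_under :: "diagram \<Rightarrow> nat \<Rightarrow> nat"
  where "nth_under D i = under_after D (nth_arc D i)"

definition meridian :: "diagram \<Rightarrow> arc word set"
  where "meridian D = wirtinger_gen D (nth_arc D 0)"

definition longitude :: "diagram \<Rightarrow> arc word set"
  where "longitude D = foldr (\<lambda>u v. u \<otimes>\<^bsub>knot_group D\<^esub> v)
    (map (\<lambda>i. let \<theta> = crossing_sign D (nth_under D i) in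
        wirtinger_gen D (nth_arc D i) [^]\<^bsub>knot_group D\<^esub> (- \<theta>) \<otimes>\<^bsub>knot_group D\<^esub>
        wirtinger_gen D (over_arc D (nth_under D i)) [^]\<^bsub>knot_group D\<^esub> \<theta>)
      [0..<card (arcs D) - 1])
    \<one>\<^bsub>knot_group D\<^esub>"

text \<open>Homomorphisms are taken extensional, so that each is counted once.\<close>

definition meridian_homs ::
  "('a, 'b) monoid_scheme \<Rightarrow> 'a \<Rightarrow> diagram \<Rightarrow> (arc word set \<Rightarrow> 'a) set"
  where "meridian_homs G x D =
    {f \<in> hom (knot_group D) G \<inter> extensional (carrier (knot_group D)). f (meridian D) = x}"

definition eisermann :: "('a, 'b) monoid_scheme \<Rightarrow> 'a \<Rightarrow> diagram \<Rightarrow> 'a multiset"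
  where "eisermann G x D = (\<Sum>f \<in> meridian_homs G x D. {# f (longitude D) #})"

definition eisermann_coeff :: "('a, 'b) monoid_scheme \<Rightarrow> 'a \<Rightarrow> diagram \<Rightarrow> 'a \<Rightarrow> nat"
  where "eisermann_coeff G x D g = card {f \<in> meridian_homs G x D. f (longitude D) = g}"

section \<open>The crossed module and the pair associated with an element of a group\<close>

definition commutator :: "('a, 'b) monoid_scheme \<Rightarrow> 'a \<Rightarrow> 'a \<Rightarrow> 'a"
  where "commutator G a b = a \<otimes>\<^bsub>G\<^esub> b \<otimes>\<^bsub>G\<^esub> inv\<^bsub>G\<^esub> a \<otimes>\<^bsub>G\<^esub> inv\<^bsub>G\<^esub> b"

definition commutator_group :: "('a, 'b) monoid_scheme \<Rightarrow> ('a, 'b) monoid_scheme"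
  where "commutator_group G = G\<lparr>carrier := derived G (carrier G)\<rparr>"

definition conj_action :: "('a, 'b) monoid_scheme \<Rightarrow> 'a \<Rightarrow> 'a \<Rightarrow> 'a"
  where "conj_action G g = (\<lambda>h \<in> carrier G. g \<otimes>\<^bsub>G\<^esub> h \<otimes>\<^bsub>G\<^esub> inv\<^bsub>G\<^esub> g)"

definition phi_pair :: "('a, 'b) monoid_scheme \<Rightarrow> 'a \<Rightarrow> 'a \<Rightarrow> 'a \<Rightarrow> 'a"
  where "phi_pair G x L M = commutator G (M \<otimes>\<^bsub>G\<^esub> inv\<^bsub>G\<^esub> x) (L \<otimes>\<^bsub>G\<^esub> inv\<^bsub>G\<^esub> x)"

definition psi_pair :: "('a, 'b) monoid_scheme \<Rightarrow> 'a \<Rightarrow> 'a \<Rightarrow> 'a \<Rightarrow> 'a"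
  where "psi_pair G x L M = commutator G L M \<otimes>\<^bsub>G\<^esub> commutator G (M \<otimes>\<^bsub>G\<^esub> inv\<^bsub>G\<^esub> L) x"

end

(* Write g_a = c(a)^-1 x c(a) for a colouring c of the arcs. With mu = id the crossing conditions for
   Phi^x say precisely that the lower under arc Y and the upper under arc Z satisfy
   c(Y) = c(Z) g_Z^-1 g_X at a positive and c(Y) = c(Z) g_Z g_X^-1 at a negative crossing with over
   arc X. Hence the g_a satisfy the Wirtinger relations, and when c = 1 at the top, c is the sequence
   of partial products of the longitude; conversely, these partial products in G recover c from a
   homomorphism sending the meridian to x. A colouring evaluates to a morphism 1 -> g given by some e
   with e * 1 = g, so e = g. That the arcs form a chain from top to bottom comes from orienting the
   diagram: every point has at most one successor and one predecessor, and the diagram is connected. *)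

theory Submission
  imports Defs
begin

section \<open>Arcs of a string knot diagram\<close>

text \<open>With \<open>id\<close> as boundary map the element at a crossing is forced by the
  colours around it: it is the lower product times the inverse of the upper one. Put Z g_Z = x Z
  into the rule for a negative crossing: it becomes Y = x Z g_X^-1, and eliminating Z from Y X Z^-1
  X^-1 yields exactly \<open>phi_pair\<close>. Likewise Y = x^-1 Z g_X and X Y X^-1 Z^-1 yield
  \<open>psi_pair\<close>. The factor of the longitude at a crossing has two roles. Its part g_Z
  commutes with itself, so only g_X acts when the conjugating element is multiplied by the factor,
  as the Wirtinger relation demands. And as a product of two conjugates of x with opposite exponents
  it lies in the commutator subgroup, so colours stay there even if x does not. The obstacle is
  combinatorial: \<open>all_links\<close> and \<open>arc_rel\<close> know no orientation,
  \<open>under_after\<close> is a definite description, and \<open>nth_arc\<close> runs on beyond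
  the bottom arc. Uniqueness and existence of the crossing that ends an arc, and the place where the
  enumeration stops, must be settled before colours and partial products can be compared.\<close>

lemma boundary_row:
  assumes "is_tangle u D w"
  shows "t < length D \<Longrightarrow> (u # map strip_bot D) ! t = strip_top (D ! t)"
    and "(u # map strip_bot D) ! length D = w"
proof -
  have "(t < length D \<longrightarrow> (u # map strip_bot D) ! t = strip_top (D ! t)) \<and>
    (u # map strip_bot D) ! length D = w"
    using assms
  proof (induction u D w arbitrary: t rule: is_tangle.induct)
    case (2 u s D w)
    then show ?case by (cases t) auto
  qed auto
  then show "t < length D \<Longrightarrow> (u # map strip_bot D) ! t = strip_top (D ! t)"
    and "(u # map strip_bot D) ! length D = w" by auto
qed

text \<open>When every point has at most one successor and one predecessor, a walk that turns round
  can only retrace its last step, so undirected components are chains.\<close>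

lemma linear_component:
  assumes "single_valued S" "single_valued (S\<inverse>)" "(p, q) \<in> (S \<union> S\<inverse>)\<^sup>*"
  shows "(p, q) \<in> S\<^sup>* \<or> (q, p) \<in> S\<^sup>*"
  using assms(3)
proof (induction rule: rtrancl_induct)
  case (step q r)
  from step.IH show ?case
  proof
    assume pq: "(p, q) \<in> S\<^sup>*"
    show ?thesis
    proof (cases "(q, r) \<in> S")
      case False
      then have "(r, q) \<in> S" using step by auto
      with pq show ?thesis
        by (cases rule: rtranclE) (use assms(2) in \<open>auto simp: single_valued_def\<close>)
    qed (use pq in auto)
  next
    assume qp: "(q, p) \<in> S\<^sup>*"
    show ?thesis
    proof (cases "(r, q) \<in> S")
      case False
      then have "(q, r) \<in> S" using step by auto
      with qp show ?thesis
        by (cases rule: converse_rtranclE) (use assms(1) in \<open>auto simp: single_valued_def\<close>)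
    qed (use qp in \<open>auto intro: converse_rtrancl_into_rtrancl\<close>)
  qed
qed auto

section \<open>Orientation of the strands, strip by strip\<close>

definition strip_links :: "diagram \<Rightarrow> nat \<Rightarrow> (point \<times> point) set"
  where "strip_links D t = over_links D t \<union>
    (if t \<in> crossings D then {(under_in_point D t, under_out_point D t)} else {})"

text \<open>Whether the strand through \<open>p\<close>, followed along its orientation, enters strip \<open>t\<close> at \<open>p\<close>.\<close>

definition enters :: "diagram \<Rightarrow> nat \<Rightarrow> point \<Rightarrow> bool"
  where "enters D t p \<longleftrightarrow> fst p = t \<and> boundary D t ! snd p = Down \<or>
    fst p = Suc t \<and> boundary D (Suc t) ! snd p = Up"

text \<open>The family \<open>L\<close> is a parameter because one orientation serves both
  \<open>over_links\<close>, whose components are the arcs, and \<open>strip_links\<close>, which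
  follows the whole knot.\<close>

definition oriented_links ::
  "diagram \<Rightarrow> (nat \<Rightarrow> (point \<times> point) set) \<Rightarrow> (point \<times> point) set"
  where "oriented_links D L =
    {(p, q). \<exists>t < length D. (p, q) \<in> L t \<union> (L t)\<inverse> \<and> enters D t p}"

lemma all_links_eq: "all_links D = (\<Union>t<length D. strip_links D t)"
  unfolding all_links_def strip_links_def by (auto simp: crossings_def split: if_splits)

text \<open>A point between two strips may have a partner in each of them. Uniqueness holds within
  one strip; the orientation then decides which strip holds the successor.\<close>

lemma strip_links_matching: "single_valued (strip_links D t \<union> (strip_links D t)\<inverse>)"
  unfolding strip_links_def over_links_def crossings_def under_in_point_def under_out_point_def
  by (cases "mid (D ! t)") (auto simp: single_valued_def Let_def)

text \<open>The under strand is cut at its crossing; this is what ends an arc there.\<close>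

lemma under_in_point_unlinked:
  assumes "t \<in> crossings D"
  shows "under_in_point D t \<notin> Field (over_links D t)"
  using assms unfolding over_links_def crossings_def under_in_point_def Field_def
  by (auto simp: Let_def)

lemma strip_links_levels:
  assumes "(p, q) \<in> strip_links D t"
  shows "fst p \<in> {t, Suc t} \<and> fst q \<in> {t, Suc t}"
  using assms
  unfolding strip_links_def over_links_def crossings_def under_in_point_def under_out_point_def
  by (auto simp: Let_def split: piece.splits if_splits)

context
  fixes D :: diagram
  assumes tangle: "is_tangle [Down] D [Down]"
begin

lemma boundary_top: "t < length D \<Longrightarrow> boundary D t = strip_top (D ! t)"
  using boundary_row(1)[OF tangle] by (simp add: boundary_def)

lemma boundary_bot: "t < length D \<Longrightarrow> boundary D (Suc t) = strip_bot (D ! t)"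
  by (simp add: boundary_def)

lemma boundary_ends: "boundary D 0 = [Down]" "boundary D (length D) = [Down]"
  using boundary_row(2)[OF tangle] by (simp_all add: boundary_def)

lemma boundary_nth:
  fixes t :: nat
  defines "l \<equiv> length (lefts (D ! t))" and "p \<equiv> mid (D ! t)"
  assumes "t < length D"
  shows "j < l \<Longrightarrow> boundary D t ! j = lefts (D ! t) ! j"
    and "j < l \<Longrightarrow> boundary D (Suc t) ! j = lefts (D ! t) ! j"
    and "i < length (piece_top p) \<Longrightarrow> boundary D t ! (l + i) = piece_top p ! i"
    and "i < length (piece_bot p) \<Longrightarrow> boundary D (Suc t) ! (l + i) = piece_bot p ! i"
    and "boundary D t ! (l + length (piece_top p) + j) = rights (D ! t) ! j"
    and "boundary D (Suc t) ! (l + length (piece_bot p) + j) = rights (D ! t) ! j"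
  using assms
  by (simp_all add: boundary_top boundary_bot strip_top_def strip_bot_def nth_append)

text \<open>A link between the two levels of a strip keeps the direction, a cup or cap reverses it;
  either way a strand that enters at one end leaves at the other.\<close>

lemma strip_links_orientation:
  assumes t: "t < length D" and "(p, q) \<in> strip_links D t"
  shows "enters D t p \<longleftrightarrow> \<not> enters D t q"
proof -
  note nth = boundary_nth[OF t]
  have Up_iff: "d = Up \<longleftrightarrow> d \<noteq> Down" for d by (cases d) auto
  \<comment> \<open>Left verticals, right verticals, cup, cap, and finally both strands of a
    crossing together: all four points of a crossing are \<open>Down\<close>, so over and under need
    not be told apart.\<close>
  consider
      j where "p = (t, j)" "q = (Suc t, j)" "j < length (lefts (D ! t))"
    | j where "p = (t, length (lefts (D ! t)) + length (piece_top (mid (D ! t))) + j)"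
        "q = (Suc t, length (lefts (D ! t)) + length (piece_bot (mid (D ! t))) + j)"
    | i d where "p = (t, i)" "q = (t, i + 1)" "i = length (lefts (D ! t))" "mid (D ! t) = Cup d"
    | i d where "p = (Suc t, i)" "q = (Suc t, i + 1)" "i = length (lefts (D ! t))"
        "mid (D ! t) = Cap d"
    | i where "i = length (lefts (D ! t))" "mid (D ! t) \<in> {XPos, XNeg}"
        "p \<in> {(t, i), (t, i + 1)}" "q \<in> {(Suc t, i), (Suc t, i + 1)}"
    using assms(2)
    unfolding strip_links_def over_links_def crossings_def under_in_point_def under_out_point_def
    by (cases "mid (D ! t)") (auto simp: Let_def t)
  then show ?thesis
  proof cases
    case 3
    then show ?thesis using nth(3)[of 0] nth(3)[of 1] by (cases d) (auto simp: enters_def)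
  next
    case 4
    then show ?thesis using nth(4)[of 0] nth(4)[of 1] by (cases d) (auto simp: enters_def)
  next
    case 5
    then show ?thesis using nth(3)[of 0] nth(3)[of 1] nth(4)[of 0] nth(4)[of 1] by (auto simp: enters_def)
  qed (simp_all add: enters_def nth Up_iff)
qed

lemma strip_links_points:
  assumes "t < length D" "(p, q) \<in> strip_links D t"
  shows "p \<in> points D \<and> q \<in> points D"
proof -
  have "length (boundary D t) =
      length (lefts (D ! t)) + length (piece_top (mid (D ! t))) + length (rights (D ! t))"
    and "length (boundary D (Suc t)) =
      length (lefts (D ! t)) + length (piece_bot (mid (D ! t))) + length (rights (D ! t))"
    using assms(1) by (simp_all add: boundary_top boundary_bot strip_top_def strip_bot_def)
  with assms show ?thesis
    unfolding strip_links_def over_links_def crossings_def under_in_point_def under_out_point_def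
    by (cases "mid (D ! t)") (auto simp: Let_def points_def)
qed

text \<open>Every link survives in one of its two directions, so passing to oriented links changes
  neither the arcs nor connectedness.\<close>

lemma oriented_links_sym:
  assumes "\<And>t. L t \<subseteq> strip_links D t"
  shows "oriented_links D L \<union> (oriented_links D L)\<inverse> =
    (\<Union>t<length D. L t) \<union> (\<Union>t<length D. L t)\<inverse>"
proof -
  have "enters D t p \<or> enters D t q" if "(p, q) \<in> L t" "t < length D" for p q t
    using strip_links_orientation[of t p q] that assms by blast
  then show ?thesis
    by (fastforce simp: oriented_links_def)
qed

lemma oriented_links_single_valued:
  assumes "\<And>t. L t \<subseteq> strip_links D t"
  shows "single_valued (oriented_links D L)" "single_valued ((oriented_links D L)\<inverse>)"
proof -
  let ?S = "\<lambda>t. strip_links D t \<union> (strip_links D t)\<inverse>"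
  have oriented: "\<exists>t<length D. (p, q) \<in> ?S t \<and> enters D t p \<and> \<not> enters D t q \<and> fst q \<in> {t, Suc t}"
    if "(p, q) \<in> oriented_links D L" for p q
    using that assms strip_links_orientation strip_links_levels
    unfolding oriented_links_def by blast
  \<comment> \<open>A point enters only the strip below it if \<open>Down\<close> and only the one
    above it if \<open>Up\<close>, so its successor is its partner in that single strip.\<close>
  have "t = s" if "enters D t p" "enters D s p" for t s p
    using that by (auto simp: enters_def)
  with oriented strip_links_matching show "single_valued (oriented_links D L)"
    by (smt (verit) single_valued_def)
  \<comment> \<open>Of the two strips meeting at a level, a point enters one and leaves the other.
    The level conditions exclude distant strips, which it does not enter either.\<close>
  have leaves: "t = s" if "\<not> enters D t p" "\<not> enters D s p" "fst p \<in> {t, Suc t}" "fst p \<in> {s, Suc s}"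
    for t s p
    using that by (auto simp: enters_def) (metis dir.exhaust)+
  show "single_valued ((oriented_links D L)\<inverse>)"
  proof (rule single_valuedI)
    fix q p p' assume "(q, p) \<in> (oriented_links D L)\<inverse>" "(q, p') \<in> (oriented_links D L)\<inverse>"
    then obtain t s where "(p, q) \<in> ?S t" "(p', q) \<in> ?S s" "t = s"
      using oriented leaves by (metis converseD)
    then have "(q, p) \<in> ?S t" "(q, p') \<in> ?S t" by blast+
    then show "p = p'"
      using strip_links_matching[of D t] by (rule single_valuedD[rotated])
  qed
qed

text \<open>Only strip \<open>0\<close> touches level \<open>0\<close>, and the top end, being
  \<open>Down\<close>, enters that strip instead of leaving it.\<close>

lemma top_no_predecessor: "(p, top_point D) \<notin> oriented_links D (strip_links D)"
proof
  assume "(p, top_point D) \<in> oriented_links D (strip_links D)"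
  then obtain t where "t < length D" "\<not> enters D t (top_point D)" "fst (top_point D) \<in> {t, Suc t}"
    using strip_links_orientation strip_links_levels unfolding oriented_links_def by blast
  then show False
    by (auto simp: enters_def top_point_def boundary_ends)
qed

lemma bot_no_successor: "(bot_point D, p) \<notin> oriented_links D (strip_links D)"
  using boundary_ends(2) by (auto simp: oriented_links_def enters_def bot_point_def)

lemma under_oriented:
  assumes "t \<in> crossings D"
  shows "(under_in_point D t, under_out_point D t) \<in> oriented_links D (strip_links D)"
proof -
  have t: "t < length D" using assms by (simp add: crossings_def)
  have "enters D t (under_in_point D t)"
    using boundary_nth(3)[OF t, of 0] boundary_nth(3)[OF t, of 1] assms
    by (auto simp: enters_def crossings_def under_in_point_def Let_def)
  then show ?thesis
    using assms t by (auto simp: oriented_links_def strip_links_def)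
qed

text \<open>One step along the knot either stays on its arc or passes under a crossing, so
  inductions along the knot need only watch the second case.\<close>

lemma oriented_links_cases:
  assumes "(p, q) \<in> oriented_links D (strip_links D)"
  obtains "(p, q) \<in> oriented_links D (over_links D)"
  | t where "t \<in> crossings D" "p = under_in_point D t" "q = under_out_point D t"
proof -
  obtain t where t: "t < length D" "(p, q) \<in> strip_links D t \<union> (strip_links D t)\<inverse>" "enters D t p"
    using assms by (auto simp: oriented_links_def)
  show thesis
  proof (cases "(p, q) \<in> over_links D t \<union> (over_links D t)\<inverse>")
    case True
    then show ?thesis using that(1) t by (auto simp: oriented_links_def)
  next
    case False
    then have *: "t \<in> crossings D"
      "(p, q) \<in> {(under_in_point D t, under_out_point D t), (under_out_point D t, under_in_point D t)}"
      using t(2) by (auto simp: strip_links_def split: if_splits)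
    have "\<not> enters D t (under_out_point D t)"
      using boundary_nth(4)[OF t(1), of 0] boundary_nth(4)[OF t(1), of 1] *(1)
      by (auto simp: enters_def crossings_def under_out_point_def Let_def)
    then show ?thesis using * that(2) t(3) by auto
  qed
qed

lemma under_in_no_over_successor:
  assumes "t \<in> crossings D"
  shows "(under_in_point D t, q) \<notin> oriented_links D (over_links D)"
proof
  assume a: "(under_in_point D t, q) \<in> oriented_links D (over_links D)"
  then obtain s where s: "(under_in_point D t, q) \<in> over_links D s \<union> (over_links D s)\<inverse>"
     "enters D s (under_in_point D t)"
    by (auto simp: oriented_links_def)
  have t: "t < length D" using assms by (simp add: crossings_def)
  have "enters D t (under_in_point D t)"
    using boundary_nth(3)[OF t, of 0] boundary_nth(3)[OF t, of 1] assms
    by (auto simp: enters_def crossings_def under_in_point_def Let_def)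
  with s have "s = t" by (auto simp: enters_def)
  with s under_in_point_unlinked[OF assms] show False by (auto simp: Field_def)
qed

section \<open>Arcs as chains and their lower ends\<close>

abbreviation "arc_links \<equiv> oriented_links D (over_links D)"

abbreviation "knot_links \<equiv> oriented_links D (strip_links D)"

lemma arc_links_knot_links: "arc_links \<subseteq> knot_links"
  by (auto simp: oriented_links_def strip_links_def)

lemma knot_links_points: "(p, q) \<in> knot_links \<Longrightarrow> p \<in> points D \<and> q \<in> points D"
  unfolding oriented_links_def using strip_links_points by blast

lemma arc_rel_eq: "arc_rel D = (arc_links \<union> arc_links\<inverse>)\<^sup>* \<inter> points D \<times> points D"
proof -
  have "arc_links \<union> arc_links\<inverse> = (\<Union>t<length D. over_links D t) \<union> (\<Union>t<length D. over_links D t)\<inverse>"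
    by (rule oriented_links_sym) (auto simp: strip_links_def)
  then show ?thesis
    by (auto simp: arc_rel_def Let_def)
qed

lemma equiv_arc_rel: "equiv (points D) (arc_rel D)"
proof (rule equivI)
  have "sym ((arc_links \<union> arc_links\<inverse>)\<^sup>*)"
    by (simp add: sym_rtrancl sym_Un_converse)
  then show "sym (arc_rel D)"
    by (auto simp: arc_rel_eq sym_def)
  show "trans (arc_rel D)"
    unfolding arc_rel_eq by (rule transI) (auto intro: rtrancl_trans)
qed (auto simp: arc_rel_eq refl_on_def)

lemma arc_of_eq: "(p, q) \<in> arc_links \<Longrightarrow> arc_of D p = arc_of D q"
  using knot_links_points[of p q] arc_links_knot_links unfolding arc_of_def
  by (intro equiv_class_eq[OF equiv_arc_rel]) (auto simp: arc_rel_eq)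

lemma arc_of_arcs: "p \<in> points D \<Longrightarrow> arc_of D p \<in> arcs D"
  by (simp add: arc_of_def arcs_def quotientI)

lemma arcs_cases:
  assumes "a \<in> arcs D"
  obtains p where "p \<in> points D" "a = arc_of D p"
  using assms by (auto simp: arc_of_def arcs_def elim: quotientE)

lemma finite_arcs: "finite (arcs D)"
proof -
  have "points D \<subseteq> (\<Union>t\<le>length D. {t} \<times> {..<length (boundary D t)})"
    by (auto simp: points_def)
  then have "finite (points D)"
    by (rule finite_subset) auto
  then show ?thesis
    unfolding arcs_def by (rule finite_quotient) (auto simp: arc_rel_eq)
qed

lemma end_points: "top_point D \<in> points D" "bot_point D \<in> points D"
  by (auto simp: points_def top_point_def bot_point_def boundary_ends)

lemma crossing_arcs:
  assumes "t \<in> crossings D"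
  shows "over_arc D t \<in> arcs D" "under_in_arc D t \<in> arcs D" "under_out_arc D t \<in> arcs D"
proof -
  have t: "t < length D" using assms by (simp add: crossings_def)
  have "over_point D t \<in> points D"
    using assms t by (auto simp: over_point_def points_def boundary_top strip_top_def crossings_def Let_def)
  then show "over_arc D t \<in> arcs D" "under_in_arc D t \<in> arcs D" "under_out_arc D t \<in> arcs D"
    unfolding over_arc_def under_in_arc_def under_out_arc_def
    using knot_links_points[OF under_oriented[OF assms]] arc_of_arcs by auto
qed

text \<open>On a chain only the last point lacks a successor. Hence an arc ends at no more than one
  crossing, as the definite description in \<open>under_after\<close> requires, and the bottom arc
  ends at none.\<close>

lemma arc_end_unique:
  assumes "arc_of D p = arc_of D q" "p \<in> points D" "q \<in> points D"
    and "\<And>r. (p, r) \<notin> arc_links" "\<And>r. (q, r) \<notin> arc_links"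
  shows "p = q"
proof -
  have "(p, q) \<in> arc_rel D"
    using assms(1-3) equiv_arc_rel unfolding arc_of_def by (metis eq_equiv_class)
  then have "(p, q) \<in> arc_links\<^sup>* \<or> (q, p) \<in> arc_links\<^sup>*"
    by (intro linear_component oriented_links_single_valued) (auto simp: arc_rel_eq strip_links_def)
  then show ?thesis
    using assms(4,5) by (auto elim: converse_rtranclE)
qed

lemma under_in_arc_inj: "inj_on (under_in_arc D) (crossings D)"
proof (rule inj_onI)
  fix s t assume *: "s \<in> crossings D" "t \<in> crossings D" "under_in_arc D s = under_in_arc D t"
  have "under_in_point D s = under_in_point D t"
    using *(3) knot_links_points[OF under_oriented] under_in_no_over_successor *(1,2)
    unfolding under_in_arc_def by (intro arc_end_unique) auto
  then show "s = t"
    by (auto simp: under_in_point_def Let_def split: if_splits)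
qed

lemma under_after_eq: "t \<in> crossings D \<Longrightarrow> under_after D (under_in_arc D t) = t"
  unfolding under_after_def using under_in_arc_inj by (auto simp: inj_on_def)

lemma under_in_arc_not_bot:
  assumes "t \<in> crossings D"
  shows "under_in_arc D t \<noteq> arc_of D (bot_point D)"
proof
  assume "under_in_arc D t = arc_of D (bot_point D)"
  then have "under_in_point D t = bot_point D"
    using knot_links_points[OF under_oriented[OF assms]] under_in_no_over_successor[OF assms]
      end_points bot_no_successor arc_links_knot_links
    unfolding under_in_arc_def by (intro arc_end_unique) auto
  then show False
    using bot_no_successor under_oriented[OF assms] by metis
qed

section \<open>Enumeration of the arcs from the top\<close>

context
  assumes connected: "\<forall>p \<in> points D. \<forall>q \<in> points D.
    (p, q) \<in> (all_links D \<union> (all_links D)\<inverse>)\<^sup>*"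
begin

lemma knot_links_linear:
  assumes "p \<in> points D" "q \<in> points D"
  shows "(p, q) \<in> knot_links\<^sup>* \<or> (q, p) \<in> knot_links\<^sup>*"
proof -
  have "knot_links \<union> knot_links\<inverse> = all_links D \<union> (all_links D)\<inverse>"
    unfolding all_links_eq by (rule oriented_links_sym) auto
  then show ?thesis
    using connected assms by (intro linear_component oriented_links_single_valued) auto
qed

lemma from_top: "p \<in> points D \<Longrightarrow> (top_point D, p) \<in> knot_links\<^sup>*"
  using knot_links_linear[OF end_points(1), of p] top_no_predecessor
  by (auto elim: rtranclE)

lemma to_bot: "p \<in> points D \<Longrightarrow> (p, bot_point D) \<in> knot_links\<^sup>*"
  using knot_links_linear[OF end_points(2), of p] bot_no_successor
  by (auto elim: converse_rtranclE)

text \<open>On the way down to the bottom end an arc can be left only by passing under a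
  crossing.\<close>

lemma under_in_arc_exists:
  assumes "a \<in> arcs D" "a \<noteq> arc_of D (bot_point D)"
  shows "\<exists>t \<in> crossings D. under_in_arc D t = a"
proof -
  obtain p where p: "p \<in> points D" "a = arc_of D p" using assms(1) by (rule arcs_cases)
  have "arc_of D p = arc_of D (bot_point D) \<or> (\<exists>t \<in> crossings D. under_in_arc D t = arc_of D p)"
    using to_bot[OF p(1)]
  proof (induction rule: converse_rtrancl_induct)
    case (step p q)
    from step.hyps(1) show ?case
      by (cases rule: oriented_links_cases) (use step.IH arc_of_eq in \<open>auto simp: under_in_arc_def\<close>)
  qed auto
  with assms(2) p(2) show ?thesis by auto
qed

text \<open>The clause on \<open>j < i\<close> keeps the index where \<open>nth_arc\<close> has a
  meaning: after the bottom arc there is no crossing for \<open>under_after\<close> to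
  select.\<close>

lemma nth_arc_exhaust:
  assumes "a \<in> arcs D"
  shows "\<exists>i. a = nth_arc D i \<and> (\<forall>j<i. nth_arc D j \<noteq> arc_of D (bot_point D))"
proof -
  obtain p where p: "p \<in> points D" "a = arc_of D p" using assms(1) by (rule arcs_cases)
  have "\<exists>i. arc_of D p = nth_arc D i \<and> (\<forall>j<i. nth_arc D j \<noteq> arc_of D (bot_point D))"
    using from_top[OF p(1)]
  proof (induction rule: rtrancl_induct)
    case base
    then show ?case by (intro exI[of _ 0]) auto
  next
    case (step p q)
    then obtain i where i: "arc_of D p = nth_arc D i" "\<forall>j<i. nth_arc D j \<noteq> arc_of D (bot_point D)"
      by auto
    from step.hyps(2) show ?case
    proof (cases rule: oriented_links_cases)
      case 1
      then show ?thesis using i arc_of_eq by auto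
    next
      case (2 t)
      then have "nth_arc D i = under_in_arc D t" using i by (simp add: under_in_arc_def)
      then have "nth_arc D (Suc i) = arc_of D q" "nth_arc D i \<noteq> arc_of D (bot_point D)"
        using 2 by (simp_all add: under_after_eq under_out_arc_def under_in_arc_not_bot)
      then show ?thesis using i by (intro exI[of _ "Suc i"]) (auto simp: less_Suc_eq)
    qed
  qed
  with p show ?thesis by simp
qed

lemma nth_arc_last_bij:
  shows "nth_arc D (card (arcs D) - 1) = arc_of D (bot_point D)"
    and "bij_betw (nth_arc D) {..<card (arcs D)} (arcs D)"
    and "card (arcs D) > 0"
proof -
  let ?b = "arc_of D (bot_point D)"
  \<comment> \<open>The first index at which the bottom arc is met; it will turn out to be the
    number of arcs minus one.\<close>
  obtain m where m: "nth_arc D m = ?b" "\<And>j. j < m \<Longrightarrow> nth_arc D j \<noteq> ?b"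
    using nth_arc_exhaust[OF arc_of_arcs[OF end_points(2)]] by metis
  \<comment> \<open>\<open>nth_arc\<close> iterates a fixed map, so repetitions persist. One at
    \<open>i < j \<le> m\<close>, shifted by \<open>m - j\<close>, would bring the bottom arc before
    index \<open>m\<close>.\<close>
  have shift: "nth_arc D (i + k) = nth_arc D (j + k)" if "nth_arc D i = nth_arc D j" for i j k
    using that by (induction k) auto
  have "inj_on (nth_arc D) {..m}"
  proof (rule linorder_inj_onI)
    fix i j assume *: "i < j" "i \<in> {..m}" "j \<in> {..m}"
    then have "nth_arc D (i + (m - j)) \<noteq> nth_arc D (j + (m - j))" using m by simp
    then show "nth_arc D i \<noteq> nth_arc D j" using shift by metis
  qed auto
  moreover have "nth_arc D i \<in> arcs D" if "i \<le> m" for i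
    using that
  proof (induction i)
    case (Suc i)
    then obtain t where "t \<in> crossings D" "under_in_arc D t = nth_arc D i"
      using under_in_arc_exists m(2) by (metis Suc_leD Suc_le_lessD)
    then have "nth_arc D (Suc i) = under_out_arc D t" "t \<in> crossings D"
      using under_after_eq by force+
    then show ?case using crossing_arcs by simp
  qed (simp add: arc_of_arcs end_points)
  moreover have "arcs D \<subseteq> nth_arc D ` {..m}"
    using nth_arc_exhaust m by (metis atMost_iff image_eqI not_le subsetI)
  ultimately have "bij_betw (nth_arc D) {..m} (arcs D)"
    by (auto simp: bij_betw_def)
  moreover have "card (arcs D) = Suc m"
    using bij_betw_same_card[OF calculation] by simp
  ultimately show "nth_arc D (card (arcs D) - 1) = ?b"
    and "bij_betw (nth_arc D) {..<card (arcs D)} (arcs D)" and "card (arcs D) > 0"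
    using m(1) by (simp_all add: lessThan_Suc_atMost)
qed

lemma nth_under:
  assumes "i < card (arcs D) - 1"
  shows "nth_under D i \<in> crossings D" "under_in_arc D (nth_under D i) = nth_arc D i"
proof -
  have "nth_arc D i \<in> arcs D"
    using assms bij_betwE[OF nth_arc_last_bij(2)] by simp
  moreover have "nth_arc D i \<noteq> arc_of D (bot_point D)"
    using assms nth_arc_last_bij(1,3) inj_onD[OF bij_betw_imp_inj_on[OF nth_arc_last_bij(2)], of i "card (arcs D) - 1"]
    by force
  ultimately obtain t where "t \<in> crossings D" "under_in_arc D t = nth_arc D i"
    using under_in_arc_exists by auto
  then show "nth_under D i \<in> crossings D" "under_in_arc D (nth_under D i) = nth_arc D i"
    using under_after_eq by (metis nth_under_def)+
qed

text \<open>The incoming under arc of \<open>t\<close> has some index, and not the last one, because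
  the bottom arc ends at no crossing. Conditions at all crossings thus become conditions along the
  enumeration.\<close>

lemma nth_under_surj:
  assumes "t \<in> crossings D"
  obtains i where "i < card (arcs D) - 1" "t = nth_under D i"
proof -
  have "under_in_arc D t \<in> nth_arc D ` {..<card (arcs D)}"
    using crossing_arcs(2)[OF assms] bij_betw_imp_surj_on[OF nth_arc_last_bij(2)] by simp
  then obtain i where i: "i < card (arcs D)" "nth_arc D i = under_in_arc D t"
    by auto
  then have "i \<noteq> card (arcs D) - 1"
    using under_in_arc_not_bot[OF assms] nth_arc_last_bij(1) by metis
  then show thesis
    using that[of i] i under_after_eq[OF assms] by (simp add: nth_under_def)
qed

end

end

section \<open>Homomorphisms from a presented group\<close>

lemma word_equiv_lists:
  "word_equiv S R v w \<Longrightarrow> v \<in> lists (S \<times> UNIV) \<and> w \<in> lists (S \<times> UNIV)"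
  by (induction rule: word_equiv.induct) auto

lemma word_equiv_context:
  assumes "word_equiv S R v w" "x \<in> lists (S \<times> UNIV)" "y \<in> lists (S \<times> UNIV)"
  shows "word_equiv S R (x @ v @ y) (x @ w @ y)"
  using assms(1)
proof (induction rule: word_equiv.induct)
  case (refl w)
  then show ?case
    using assms by (intro word_equiv.refl) simp
next
  case (sym v w)
  then show ?case by (rule_tac word_equiv.sym)
next
  case (trans u v w)
  then show ?case by (blast intro: word_equiv.trans)
next
  case (cancel u v a b)
  then show ?case
    using word_equiv.cancel[of "x @ u" S "v @ y" a R b] assms by simp
next
  case (relation u v r s)
  then show ?case
    using word_equiv.relation[of "x @ u" S "v @ y" r s R] assms by simp
qed

text \<open>Compatibility with concatenation makes all the classes united in the product of
  \<open>presented_group\<close> coincide.\<close>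

lemma word_equiv_append:
  assumes "word_equiv S R u u'" "word_equiv S R v v'"
  shows "word_equiv S R (u @ v) (u' @ v')"
proof -
  have "word_equiv S R (u @ v) (u' @ v)"
    using word_equiv_context[OF assms(1), of "[]" v] word_equiv_lists[OF assms(2)] by simp
  moreover have "word_equiv S R (u' @ v) (u' @ v')"
    using word_equiv_context[OF assms(2), of u' "[]"] word_equiv_lists[OF assms(1)] by simp
  ultimately show ?thesis by (rule word_equiv.trans)
qed

lemma word_class_eqI: "word_equiv S R v w \<Longrightarrow> word_class S R v = word_class S R w"
  unfolding word_class_def by (blast intro: word_equiv.sym word_equiv.trans)

lemma word_class_self: "w \<in> lists (S \<times> UNIV) \<Longrightarrow> w \<in> word_class S R w"
  by (simp add: word_class_def word_equiv.refl)

lemma presented_group_simps: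
  "carrier (presented_group S R) = word_class S R ` lists (S \<times> UNIV)"
  "\<one>\<^bsub>presented_group S R\<^esub> = word_class S R []"
  by (simp_all add: presented_group_def)

lemma presented_group_mult:
  assumes "u \<in> lists (S \<times> UNIV)" "v \<in> lists (S \<times> UNIV)"
  shows "word_class S R u \<otimes>\<^bsub>presented_group S R\<^esub> word_class S R v = word_class S R (u @ v)"
proof -
  have "word_class S R (u' @ v') = word_class S R (u @ v)"
    if "u' \<in> word_class S R u" "v' \<in> word_class S R v" for u' v'
    using word_class_eqI[OF word_equiv_append, of S R u u' v v'] that by (simp add: word_class_def)
  moreover have "u \<in> word_class S R u" "v \<in> word_class S R v"
    using assms by (auto intro: word_class_self)
  ultimately have "(\<Union>u' \<in> word_class S R u. \<Union>v' \<in> word_class S R v. word_class S R (u' @ v')) =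
      word_class S R (u @ v)"
    by blast
  then show ?thesis
    by (simp add: presented_group_def)
qed

definition inverse_word :: "'g word \<Rightarrow> 'g word"
  where "inverse_word w = rev (map (\<lambda>(a, b). (a, \<not> b)) w)"

lemma inverse_word_lists:
  "w \<in> lists (S \<times> UNIV) \<Longrightarrow> inverse_word w \<in> lists (S \<times> UNIV)"
  by (induction w) (auto simp: inverse_word_def)

lemma inverse_word_cancel:
  "w \<in> lists (S \<times> UNIV) \<Longrightarrow> word_equiv S R (inverse_word w @ w) []"
proof (induction w)
  case Nil
  then show ?case by (simp add: inverse_word_def word_equiv.refl)
next
  case (Cons x w)
  obtain a b where x: "x = (a, b)" by (cases x)
  \<comment> \<open>The adjacent pair in the middle cancels; the double negation gives it the shape
    that the rule \<open>cancel\<close> expects.\<close>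
  have "word_equiv S R (inverse_word w @ [(a, \<not> b), (a, \<not> \<not> b)] @ w) (inverse_word w @ w)"
    using Cons.prems x by (intro word_equiv.cancel inverse_word_lists) auto
  then show ?case
    using word_equiv.trans[OF _ Cons.IH] Cons.prems x by (simp add: inverse_word_def)
qed

lemma group_presented_group: "group (presented_group S R)" (is "group ?P")
proof (rule groupI)
  fix A B assume "A \<in> carrier ?P" "B \<in> carrier ?P"
  then obtain u v where u: "u \<in> lists (S \<times> UNIV)" "A = word_class S R u"
    and v: "v \<in> lists (S \<times> UNIV)" "B = word_class S R v"
    unfolding presented_group_simps by blast
  have uv: "u @ v \<in> lists (S \<times> UNIV)" using u v by simp
  show "A \<otimes>\<^bsub>?P\<^esub> B \<in> carrier ?P"
    unfolding u v presented_group_mult[OF u(1) v(1)] presented_group_simps using uv by (rule imageI)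
  fix C assume "C \<in> carrier ?P"
  then obtain w where w: "w \<in> lists (S \<times> UNIV)" "C = word_class S R w"
    unfolding presented_group_simps by blast
  have vw: "v @ w \<in> lists (S \<times> UNIV)" using w v by simp
  show "A \<otimes>\<^bsub>?P\<^esub> B \<otimes>\<^bsub>?P\<^esub> C = A \<otimes>\<^bsub>?P\<^esub> (B \<otimes>\<^bsub>?P\<^esub> C)"
    unfolding u v w presented_group_mult[OF u(1) v(1)] presented_group_mult[OF v(1) w(1)]
      presented_group_mult[OF uv w(1)] presented_group_mult[OF u(1) vw] by simp
next
  show "\<one>\<^bsub>?P\<^esub> \<in> carrier ?P"
    by (simp add: presented_group_simps)
  show "\<one>\<^bsub>?P\<^esub> \<otimes>\<^bsub>?P\<^esub> A = A" if "A \<in> carrier ?P" for A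
    using that by (auto simp: presented_group_simps presented_group_mult in_lists_conv_set)
  fix A assume "A \<in> carrier ?P"
  then obtain w where "w \<in> lists (S \<times> UNIV)" "A = word_class S R w"
    by (auto simp: presented_group_simps)
  then show "\<exists>B \<in> carrier ?P. B \<otimes>\<^bsub>?P\<^esub> A = \<one>\<^bsub>?P\<^esub>"
    using inverse_word_lists[of w S] word_class_eqI[OF inverse_word_cancel[of w S R]]
    by (intro bexI[of _ "word_class S R (inverse_word w)"])
      (simp_all add: presented_group_mult presented_group_simps)
qed

section \<open>Values of words in a group and the universal property\<close>

definition word_val :: "('a, 'b) monoid_scheme \<Rightarrow> ('g \<Rightarrow> 'a) \<Rightarrow> 'g word \<Rightarrow> 'a"
  where "word_val G \<gamma> w =
    foldr (\<lambda>(a, b) y. (if b then \<gamma> a else inv\<^bsub>G\<^esub> \<gamma> a) \<otimes>\<^bsub>G\<^esub> y) w \<one>\<^bsub>G\<^esub>"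

lemma word_val_simps [simp]:
  "word_val G \<gamma> [] = \<one>\<^bsub>G\<^esub>"
  "word_val G \<gamma> ((a, b) # w) = (if b then \<gamma> a else inv\<^bsub>G\<^esub> \<gamma> a) \<otimes>\<^bsub>G\<^esub> word_val G \<gamma> w"
  by (simp_all add: word_val_def)

context group
begin

lemma word_val_closed:
  "\<gamma> \<in> S \<rightarrow> carrier G \<Longrightarrow> w \<in> lists (S \<times> UNIV) \<Longrightarrow> word_val G \<gamma> w \<in> carrier G"
  by (induction w) (auto simp: Pi_iff)

lemma word_val_append:
  "\<gamma> \<in> S \<rightarrow> carrier G \<Longrightarrow> v \<in> lists (S \<times> UNIV) \<Longrightarrow> w \<in> lists (S \<times> UNIV) \<Longrightarrow>
    word_val G \<gamma> (v @ w) = word_val G \<gamma> v \<otimes> word_val G \<gamma> w"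
  by (induction v) (auto simp: m_assoc word_val_closed[of \<gamma> S] Pi_iff in_lists_conv_set)

text \<open>Only pairs of words over \<open>S\<close> are tested, matching the side conditions of
  the rule \<open>relation\<close>.\<close>

definition respects_relations :: "'g set \<Rightarrow> ('g word \<times> 'g word) set \<Rightarrow> ('g \<Rightarrow> 'a) \<Rightarrow> bool"
  where "respects_relations S R \<gamma> \<longleftrightarrow> (\<forall>(r, s) \<in> R.
    r \<in> lists (S \<times> UNIV) \<longrightarrow> s \<in> lists (S \<times> UNIV) \<longrightarrow> word_val G \<gamma> r = word_val G \<gamma> s)"

lemma word_val_equiv:
  assumes "word_equiv S R v w" "\<gamma> \<in> S \<rightarrow> carrier G" "respects_relations S R \<gamma>"
  shows "word_val G \<gamma> v = word_val G \<gamma> w"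
  using assms(1)
proof (induction rule: word_equiv.induct)
  case (cancel u v a b)
  have "\<gamma> a \<in> carrier G" "word_val G \<gamma> v \<in> carrier G"
    using cancel assms word_val_closed by auto
  then have "word_val G \<gamma> ([(a, b), (a, \<not> b)] @ v) = word_val G \<gamma> v"
    by (simp flip: m_assoc)
  then show ?case
    using cancel word_val_append[OF assms(2), of u "[(a, b), (a, \<not> b)] @ v"]
      word_val_append[OF assms(2), of u v] by simp
next
  case (relation u v r s)
  then show ?case
    using assms by (auto simp: word_val_append[OF assms(2)] respects_relations_def)
qed auto

lemma hom_word_class:
  assumes f: "f \<in> hom (presented_group S R) G" and "w \<in> lists (S \<times> UNIV)"
  shows "f (word_class S R w) = word_val G (\<lambda>a \<in> S. f (word_class S R [(a, True)])) w"
proof -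
  interpret f: group_hom "presented_group S R" G f
    by (intro group_hom.intro group_hom_axioms.intro group_presented_group is_group f)
  have inv: "f (word_class S R [(a, False)]) = inv f (word_class S R [(a, True)])" if "a \<in> S" for a
  proof -
    have gen: "[(a, b)] \<in> lists (S \<times> UNIV)" for b using that by simp
    have "word_class S R [(a, False)] \<otimes>\<^bsub>presented_group S R\<^esub> word_class S R [(a, True)]
        = \<one>\<^bsub>presented_group S R\<^esub>"
      using that word_equiv.cancel[of "[]" S "[]" a R False]
      by (simp add: presented_group_mult presented_group_simps word_class_eqI)
    then have "word_class S R [(a, False)] = inv\<^bsub>presented_group S R\<^esub> word_class S R [(a, True)]"
      using gen by (intro f.G.inv_equality[symmetric]) (auto simp: presented_group_simps)
    then show ?thesis
      using gen by (auto simp: presented_group_simps)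
  qed
  show ?thesis
    using assms(2)
  proof (induction w)
    case Nil
    then show ?case using f.hom_one by (simp add: presented_group_simps)
  next
    case (Cons x w)
    obtain a b where x: "x = (a, b)" by (cases x)
    have a: "a \<in> S" "[(a, b)] \<in> lists (S \<times> UNIV)" "w \<in> lists (S \<times> UNIV)"
      using Cons.hyps x by auto
    then have "f (word_class S R [(a, b)] \<otimes>\<^bsub>presented_group S R\<^esub> word_class S R w) =
        f (word_class S R [(a, b)]) \<otimes> f (word_class S R w)"
      by (intro f.hom_mult) (simp_all add: presented_group_simps)
    then have "f (word_class S R (x # w)) = f (word_class S R [(a, b)]) \<otimes> f (word_class S R w)"
      by (simp only: presented_group_mult[OF a(2,3)] x append_Cons append_Nil)
    then show ?case
      using Cons.IH a inv by (cases b) (simp_all add: x)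
  qed
qed

text \<open>The universal property of the presentation. Extensionality on both sides makes it a
  bijection, so counting homomorphisms becomes counting labels of generators.\<close>

lemma presented_group_homs:
  "bij_betw (\<lambda>f. \<lambda>a \<in> S. f (word_class S R [(a, True)]))
    (hom (presented_group S R) G \<inter> extensional (carrier (presented_group S R)))
    {\<gamma> \<in> S \<rightarrow>\<^sub>E carrier G. respects_relations S R \<gamma>}"
  (is "bij_betw ?r ?A ?B")
  unfolding bij_betw_def
proof
  show "inj_on ?r ?A"
  proof (rule inj_onI)
    fix f g assume *: "f \<in> ?A" "g \<in> ?A" "?r f = ?r g"
    show "f = g"
    proof (rule extensionalityI)
      fix A assume "A \<in> carrier (presented_group S R)"
      then obtain w where "w \<in> lists (S \<times> UNIV)" "A = word_class S R w"
        by (auto simp: presented_group_simps)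
      with * show "f A = g A" by (simp add: hom_word_class)
    qed (use * in auto)
  qed
  show "?r ` ?A = ?B"
  proof (intro equalityI subsetI)
    fix \<gamma> assume "\<gamma> \<in> ?r ` ?A"
    then obtain f where f: "f \<in> hom (presented_group S R) G" "\<gamma> = ?r f" by auto
    have "f (word_class S R [(a, True)]) \<in> carrier G" if "a \<in> S" for a
      using that hom_in_carrier[OF f(1)] by (auto simp: presented_group_simps)
    moreover have "word_val G (?r f) r = word_val G (?r f) s"
      if rs: "(r, s) \<in> R" "r \<in> lists (S \<times> UNIV)" "s \<in> lists (S \<times> UNIV)" for r s
    proof -
      have "word_class S R r = word_class S R s"
        using word_equiv.relation[of "[]" S "[]" r s R] rs by (intro word_class_eqI) simp
      then show ?thesis
        by (simp only: hom_word_class[OF f(1), symmetric] rs)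
    qed
    then have "respects_relations S R \<gamma>"
      unfolding respects_relations_def f(2) by blast
    ultimately show "\<gamma> \<in> ?B" using f(2) by auto
  next
    fix \<gamma> assume "\<gamma> \<in> ?B"
    then have \<gamma>: "\<gamma> \<in> S \<rightarrow> carrier G" "\<gamma> \<in> extensional S" "respects_relations S R \<gamma>"
      by (auto simp: PiE_def)
    \<comment> \<open>Any representative will do, since \<open>word_val_equiv\<close> makes the
      value constant on a class.\<close>
    define f where "f = (\<lambda>A \<in> carrier (presented_group S R). word_val G \<gamma> (SOME w. w \<in> A))"
    have f: "f (word_class S R w) = word_val G \<gamma> w" if "w \<in> lists (S \<times> UNIV)" for w
    proof -
      have "(SOME v. v \<in> word_class S R w) \<in> word_class S R w"
        using word_class_self[OF that] by (rule someI)
      then show ?thesis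
        using that word_val_equiv[OF _ \<gamma>(1,3)]
        by (auto simp: f_def presented_group_simps word_class_def)
    qed
    have "f \<in> ?A"
    proof
      show "f \<in> extensional (carrier (presented_group S R))"
        by (simp add: f_def)
      show "f \<in> hom (presented_group S R) G"
        using word_val_closed[OF \<gamma>(1)] word_val_append[OF \<gamma>(1)]
        by (intro homI) (auto simp: presented_group_simps presented_group_mult f
          in_lists_conv_set ball_Un)
    qed
    moreover have "\<gamma> = ?r f"
      using \<gamma> by (intro extensionalityI[of _ S]) (auto simp: f Pi_iff)
    ultimately show "\<gamma> \<in> ?r ` ?A" by blast
  qed
qed

end

section \<open>The Reidemeister pair\<close>

context group
begin

text \<open>Together with \<open>group_word_simps\<close> these rules reduce words as in a free
  group, so word identities can be left to simplification.\<close>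

lemma inv_cancel [simp]:
  assumes "a \<in> carrier G" "b \<in> carrier G"
  shows "a \<otimes> (inv a \<otimes> b) = b" "inv a \<otimes> (a \<otimes> b) = b"
  using assms by (simp_all flip: m_assoc)

lemmas group_word_simps = m_assoc inv_mult_group

lemma conj_action_simps:
  "h \<in> carrier G \<Longrightarrow> conj_action G g h = g \<otimes> h \<otimes> inv g"
  by (simp add: conj_action_def)

lemma conj_action_in_auto:
  assumes g: "g \<in> carrier G"
  shows "conj_action G g \<in> auto G"
proof -
  have "bij_betw (conj_action G g) (carrier G) (carrier G)"
    by (rule bij_betw_byWitness[where f' = "conj_action G (inv g)"])
      (use g in \<open>auto simp: conj_action_simps group_word_simps\<close>)
  moreover have "conj_action G g \<in> hom G G"
    using g by (auto intro!: homI simp: conj_action_simps group_word_simps)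
  ultimately show ?thesis
    by (simp add: auto_def Bij_def conj_action_def)
qed

lemma crossed_module_id: "crossed_module G G id (conj_action G)"
proof
  show "id \<in> hom G G" by (auto intro: homI)
  show "conj_action G \<in> hom G (AutoGroup G)"
  proof (rule homI)
    fix g h assume gh: "g \<in> carrier G" "h \<in> carrier G"
    then have "conj_action G g \<in> Bij (carrier G)" "conj_action G h \<in> Bij (carrier G)"
      using conj_action_in_auto by (auto simp: auto_def)
    then have "conj_action G g \<otimes>\<^bsub>AutoGroup G\<^esub> conj_action G h
        = compose (carrier G) (conj_action G g) (conj_action G h)"
      by (simp add: AutoGroup_def BijGroup_def)
    also have "\<dots> = conj_action G (g \<otimes> h)"
      using gh by (intro extensionalityI[of _ "carrier G"])
        (auto simp: compose_def conj_action_def group_word_simps)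
    finally show "conj_action G (g \<otimes> h) = conj_action G g \<otimes>\<^bsub>AutoGroup G\<^esub> conj_action G h" ..
  qed (simp add: AutoGroup_def conj_action_in_auto)
qed (auto simp: conj_action_simps)

lemma derived_subgroup: "subgroup (derived G (carrier G)) G"
  by (simp add: derived_is_subgroup)

lemma derived_carrier: "a \<in> derived G (carrier G) \<Longrightarrow> a \<in> carrier G"
  using derived_in_carrier by blast

lemma commutator_in_derived:
  "a \<in> carrier G \<Longrightarrow> b \<in> carrier G \<Longrightarrow> commutator G a b \<in> derived G (carrier G)"
  unfolding commutator_def derived_def by (intro generate.incl) blast

lemma commutator_group_simps:
  "carrier (commutator_group G) = derived G (carrier G)"
  "a \<otimes>\<^bsub>commutator_group G\<^esub> b = a \<otimes> b"
  "\<one>\<^bsub>commutator_group G\<^esub> = \<one>"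
  "a \<in> derived G (carrier G) \<Longrightarrow> inv\<^bsub>commutator_group G\<^esub> a = inv a"
  unfolding commutator_group_def using m_inv_consistent[OF derived_subgroup] by auto

lemma group_commutator_group: "group (commutator_group G)"
  unfolding commutator_group_def using derived_subgroup subgroup_imp_group by blast

abbreviation "G' \<equiv> commutator_group G"

text \<open>The value at the Wirtinger generator of an arc coloured \<open>a\<close>.\<close>

definition label_gen :: "'a \<Rightarrow> 'a \<Rightarrow> 'a"
  where "label_gen x a = inv a \<otimes> x \<otimes> a"

lemma label_gen_closed [simp]:
  "x \<in> carrier G \<Longrightarrow> a \<in> carrier G \<Longrightarrow> label_gen x a \<in> carrier G"
  by (simp add: label_gen_def)

lemma phi_pair_word:
  assumes "x \<in> carrier G" "L \<in> carrier G" "M \<in> carrier G"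
  shows "phi_pair G x L M = M \<otimes> inv x \<otimes> L \<otimes> inv M \<otimes> x \<otimes> inv L"
  using assms by (simp add: phi_pair_def commutator_def group_word_simps)

lemma psi_pair_word:
  assumes "x \<in> carrier G" "L \<in> carrier G" "M \<in> carrier G"
  shows "psi_pair G x L M =
    L \<otimes> M \<otimes> inv L \<otimes> inv L \<otimes> x \<otimes> L \<otimes> inv M \<otimes> inv x"
  using assms by (simp add: psi_pair_def commutator_def group_word_simps)

text \<open>\<open>phi_pair\<close> is a commutator in \<open>G\<close> and \<open>psi_pair\<close>
  a product of two, wherever \<open>x\<close> lies.\<close>

lemma pair_in_derived:
  assumes "x \<in> carrier G" "L \<in> carrier G" "M \<in> carrier G"
  shows "phi_pair G x L M \<in> derived G (carrier G)" "psi_pair G x L M \<in> derived G (carrier G)"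
  using assms
  by (simp_all add: phi_pair_def psi_pair_def commutator_in_derived
    subgroup.m_closed[OF derived_subgroup])

text \<open>With g_X = \<open>label_gen x X\<close> the right-hand side is x^-1 Y g_X; in the
  positive case below it is x Y g_X^-1.\<close>

lemma neg_crossing_word:
  assumes "x \<in> carrier G" "X \<in> carrier G" "Y \<in> carrier G"
  shows "inv X \<otimes> inv (phi_pair G x X Y) \<otimes> Y \<otimes> X = inv x \<otimes> Y \<otimes> inv X \<otimes> x \<otimes> X"
  using assms by (simp add: phi_pair_word group_word_simps)

lemma pos_crossing_word:
  assumes "x \<in> carrier G" "X \<in> carrier G" "Y \<in> carrier G"
  shows "inv (psi_pair G x X Y) \<otimes> X \<otimes> Y \<otimes> inv X = x \<otimes> Y \<otimes> inv X \<otimes> inv x \<otimes> X"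
  using assms by (simp add: psi_pair_word group_word_simps)

text \<open>Since \<open>Z \<otimes> label_gen x Z = x \<otimes> Z\<close>, the second equation is Y
  = x Z g_X^-1, and \<open>neg_crossing_word\<close> is its solution for Z. The positive case has
  x^-1 and g_X instead.\<close>

lemma neg_crossing_step:
  assumes "x \<in> carrier G" "X \<in> carrier G" "Y \<in> carrier G" "Z \<in> carrier G"
  shows "Z = inv X \<otimes> inv (phi_pair G x X Y) \<otimes> Y \<otimes> X \<longleftrightarrow>
    Y = Z \<otimes> (label_gen x Z \<otimes> inv (label_gen x X))"
  unfolding neg_crossing_word[OF assms(1-3)] using assms
  by (auto simp: label_gen_def group_word_simps)

lemma pos_crossing_step:
  assumes "x \<in> carrier G" "X \<in> carrier G" "Y \<in> carrier G" "Z \<in> carrier G"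
  shows "Z = inv (psi_pair G x X Y) \<otimes> X \<otimes> Y \<otimes> inv X \<longleftrightarrow>
    Y = Z \<otimes> (inv (label_gen x Z) \<otimes> label_gen x X)"
  unfolding pos_crossing_word[OF assms(1-3)] using assms
  by (auto simp: label_gen_def group_word_simps)

lemma unframed_reidemeister_pair_commutator_group:
  assumes x: "x \<in> carrier G"
  shows "unframed_reidemeister_pair G' G' id
    (conj_action G') (psi_pair G x) (phi_pair G x)"
proof -
  interpret K: group G' by (rule group_commutator_group)
  interpret crossed_module G' G' id "conj_action G'"
    by (rule K.crossed_module_id)
  \<comment> \<open>The left side is formed in \<open>G'\<close>, but the words contain
    \<open>x\<close>, which need not lie there; all computation is therefore moved to
    \<open>G\<close>.\<close>
  have neg: "inv\<^bsub>G'\<^esub> X \<otimes>\<^bsub>G'\<^esub> inv\<^bsub>G'\<^esub> (id (phi_pair G x X Y)) \<otimes>\<^bsub>G'\<^esub> Y \<otimes>\<^bsub>G'\<^esub> X =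
      inv x \<otimes> Y \<otimes> inv X \<otimes> x \<otimes> X"
    if "X \<in> carrier G'" "Y \<in> carrier G'" for X Y
    using that x
    by (simp add: commutator_group_simps pair_in_derived derived_carrier neg_crossing_word)
  show ?thesis
  proof
    fix X Y assume XY: "X \<in> carrier G'" "Y \<in> carrier G'"
    then have XY': "X \<in> carrier G" "Y \<in> carrier G" by (simp_all add: commutator_group_simps derived_carrier)
    show "psi_pair G x X Y \<in> carrier G'" "phi_pair G x X Y \<in> carrier G'"
      using XY' x by (simp_all add: commutator_group_simps pair_in_derived)
    show "psi_pair G x X X = \<one>\<^bsub>G'\<^esub>"
      using XY' x by (simp add: commutator_group_simps psi_pair_word group_word_simps)
    fix Z assume "Z = inv\<^bsub>G'\<^esub> X \<otimes>\<^bsub>G'\<^esub> inv\<^bsub>G'\<^esub> (id (phi_pair G x X Y))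
      \<otimes>\<^bsub>G'\<^esub> Y \<otimes>\<^bsub>G'\<^esub> X"
    then have "Z = inv x \<otimes> Y \<otimes> inv X \<otimes> x \<otimes> X" using neg[OF XY] by simp
    then show "phi_pair G x X Y \<otimes>\<^bsub>G'\<^esub> psi_pair G x X Z = \<one>\<^bsub>G'\<^esub>"
      using XY' x by (simp add: commutator_group_simps psi_pair_word phi_pair_word group_word_simps)
  next
    fix X Y T Z V W
    assume XYT: "X \<in> carrier G'" "Y \<in> carrier G'" "T \<in> carrier G'"
    assume "Z = inv\<^bsub>G'\<^esub> Y \<otimes>\<^bsub>G'\<^esub> inv\<^bsub>G'\<^esub> (id (phi_pair G x Y X))
      \<otimes>\<^bsub>G'\<^esub> X \<otimes>\<^bsub>G'\<^esub> Y"
    and "V = inv\<^bsub>G'\<^esub> T \<otimes>\<^bsub>G'\<^esub> inv\<^bsub>G'\<^esub> (id (phi_pair G x T Y))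
      \<otimes>\<^bsub>G'\<^esub> Y \<otimes>\<^bsub>G'\<^esub> T"
    and "W = inv\<^bsub>G'\<^esub> T \<otimes>\<^bsub>G'\<^esub> inv\<^bsub>G'\<^esub> (id (phi_pair G x T X))
      \<otimes>\<^bsub>G'\<^esub> X \<otimes>\<^bsub>G'\<^esub> T"
    then have ZVW: "Z = inv x \<otimes> X \<otimes> inv Y \<otimes> x \<otimes> Y" "V = inv x \<otimes> Y \<otimes> inv T \<otimes> x \<otimes> T"
        "W = inv x \<otimes> X \<otimes> inv T \<otimes> x \<otimes> T"
      using neg XYT by simp_all
    have c: "X \<in> carrier G" "Y \<in> carrier G" "T \<in> carrier G"
      using XYT by (simp_all add: commutator_group_simps derived_carrier)
    have "Z \<in> carrier G" "V \<in> carrier G" "W \<in> carrier G"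
      using c x by (simp_all add: ZVW)
    note mems = this pair_in_derived(1)[OF x]
    \<comment> \<open>Each side is X Y T divided by T V times a third upper colour, x^-2 X g_Y g_T
      on the left and x^-2 X g_T g_V on the right. They agree because g_T g_V = g_Y g_T; the
      simplifier sees equal reduced words in x, X, Y, T.\<close>
    show "phi_pair G x Y X \<otimes>\<^bsub>G'\<^esub>
        conj_action G' Y (phi_pair G x T Z) \<otimes>\<^bsub>G'\<^esub> phi_pair G x T Y =
        conj_action G' X (phi_pair G x T Y) \<otimes>\<^bsub>G'\<^esub> phi_pair G x T X
        \<otimes>\<^bsub>G'\<^esub> conj_action G' T (phi_pair G x V W)"
      using XYT c x mems
      by (simp add: K.conj_action_simps commutator_group_simps)
        (simp add: phi_pair_word ZVW group_word_simps)
  qed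
qed

end

section \<open>Evaluation of a coloured diagram\<close>

lemma over_link_arc:
  assumes "is_tangle [Down] D [Down]" "t < length D" "(p, q) \<in> over_links D t"
  shows "arc_of D p = arc_of D q"
proof -
  have "(p, q) \<in> oriented_links D (over_links D) \<union> (oriented_links D (over_links D))\<inverse>"
    using assms oriented_links_sym[OF assms(1), of "over_links D"] by (auto simp: strip_links_def)
  then show ?thesis
    using arc_of_eq[OF assms(1), of p q] arc_of_eq[OF assms(1), of q p] by auto
qed

lemma map_upt_shift:
  assumes "\<And>j. j < r \<Longrightarrow> f (a + j) = g (b + j)"
  shows "map f [a..<a + r] = map g [b..<b + r]"
  using assms by (intro nth_equalityI) auto

context group
begin

text \<open>Membership in \<open>mor_set\<close> for the boundary map \<open>id\<close>, with source
  and target taken from the morphism itself.\<close>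

definition valid_mor :: "('a, 'a) mor \<Rightarrow> bool"
  where "valid_mor f \<longleftrightarrow>
    source f \<in> carrier G \<and> elt f \<in> carrier G \<and> target f = elt f \<otimes> source f"

definition row_prod :: "'a list \<Rightarrow> 'a"
  where "row_prod xs = foldr (\<otimes>) xs \<one>"

lemma row_prod_simps [simp]: "row_prod [] = \<one>" "row_prod (a # xs) = a \<otimes> row_prod xs"
  by (simp_all add: row_prod_def)

lemma row_prod_closed [simp]: "set xs \<subseteq> carrier G \<Longrightarrow> row_prod xs \<in> carrier G"
  by (induction xs) auto

lemma row_prod_append:
  "set xs \<subseteq> carrier G \<Longrightarrow> set ys \<subseteq> carrier G \<Longrightarrow> row_prod (xs @ ys) = row_prod xs \<otimes> row_prod ys"
  by (induction xs) (auto simp: m_assoc)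

text \<open>For e : U -> V and e' : U' -> V' one has V e' V^-1 e U U' = V e' U' = V V', because e U
  = V.\<close>

lemma valid_mor_tensor:
  assumes "valid_mor f" "valid_mor g"
  shows "valid_mor (mor_tensor G G (conj_action G) f g)"
  using assms by (simp add: valid_mor_def mor_tensor_def conj_action_simps group_word_simps)

lemma valid_mor_comp:
  assumes "valid_mor f" "valid_mor g" "target f = source g"
  shows "valid_mor (mor_comp G f g)"
  using assms by (auto simp: valid_mor_def mor_comp_def m_assoc)

lemma foldr_tensor:
  defines "T \<equiv> \<lambda>fs. foldr (mor_tensor G G (conj_action G)) fs (mor_id G \<one>)"
  assumes "\<And>f. f \<in> set fs \<Longrightarrow> valid_mor f"
  shows "valid_mor (T fs)" "source (T fs) = row_prod (map source fs)"
    "target (T fs) = row_prod (map target fs)"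
proof -
  have "valid_mor (T fs) \<and> source (T fs) = row_prod (map source fs) \<and>
      target (T fs) = row_prod (map target fs)"
    using assms(2)
  proof (induction fs)
    case Nil
    then show ?case by (simp add: T_def valid_mor_def mor_id_def)
  next
    case (Cons f fs)
    then show ?case
      using valid_mor_tensor[of f "T fs"] by (simp add: T_def) (simp add: mor_tensor_def)
  qed
  then show "valid_mor (T fs)" "source (T fs) = row_prod (map source fs)"
    "target (T fs) = row_prod (map target fs)" by auto
qed

section \<open>Rows of a coloured diagram\<close>

context
  fixes D :: diagram and c :: "arc \<Rightarrow> 'a" and d :: "nat \<Rightarrow> 'a"
  assumes tangle: "is_tangle [Down] D [Down]"
    and labels: "c \<in> arcs D \<rightarrow> carrier G"
    and crossing_labels: "\<And>t. t \<in> crossings D \<Longrightarrow> d t \<in> carrier G"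
    and crossing_mor: "\<And>t. t \<in> crossings D \<Longrightarrow>
      (if mid (D ! t) = XPos
       then d t \<otimes> (c (under_in_arc D t) \<otimes> c (over_arc D t)) = c (over_arc D t) \<otimes> c (under_out_arc D t)
       else d t \<otimes> (c (over_arc D t) \<otimes> c (under_in_arc D t)) = c (under_out_arc D t) \<otimes> c (over_arc D t))"
begin

abbreviation "obj \<equiv> point_obj G D c"

definition row :: "nat \<Rightarrow> 'a"
  where "row t = row_prod (map (obj t) [0..<length (boundary D t)])"

lemma obj_closed: "(t, j) \<in> points D \<Longrightarrow> obj t j \<in> carrier G"
  using labels arc_of_arcs[OF tangle] by (auto simp: point_obj_def Pi_iff split: dir.split)

lemma strip_eval_row:
  assumes t: "t < length D"
  defines "S \<equiv> strip_eval G G (conj_action G) D (c, d) t"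
  shows "valid_mor S" "source S = row t" "target S = row (Suc t)"
proof -
  define l where "l = length (lefts (D ! t))"
  define p where "p = mid (D ! t)"
  define r where "r = length (rights (D ! t))"
  define k where "k = length (piece_top p)"
  define k' where "k' = length (piece_bot p)"
  note defs = l_def p_def r_def k_def k'_def
  have len: "length (boundary D t) = l + k + r" "length (boundary D (Suc t)) = l + k' + r"
    using t by (simp_all add: boundary_top[OF tangle] boundary_bot[OF tangle] strip_top_def strip_bot_def defs)
  have closed: "j < l + k + r \<Longrightarrow> obj t j \<in> carrier G"
    "j < l + k' + r \<Longrightarrow> obj (Suc t) j \<in> carrier G" for j
    using t by (auto intro!: obj_closed simp: points_def len)
  note nth = boundary_nth[OF tangle t, folded defs, folded k_def k'_def]
  note link = over_link_arc[OF tangle t]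
  have left: "obj t j = obj (Suc t) j" if "j < l" for j
    using that link[of "(t, j)" "(Suc t, j)"] nth(1,2)[of j]
    by (simp add: point_obj_def over_links_def Let_def l_def split: dir.split)
  have right: "obj t (l + k + j) = obj (Suc t) (l + k' + j)" if "j < r" for j
    using that link[of "(t, l + k + j)" "(Suc t, l + k' + j)"] nth(5,6)[of j]
    by (simp add: point_obj_def over_links_def Let_def defs split: dir.split)
  define vertical where "vertical = (\<lambda>j. mor_id G (obj t j))"
  define M where "M = piece_eval G G D (c, d) t"
  define fs where "fs = map vertical [0..<l] @ M @ map vertical [l + k..<l + k + r]"
  have S: "S = foldr (mor_tensor G G (conj_action G)) fs (mor_id G \<one>)"
    by (simp add: S_def strip_eval_def fs_def M_def vertical_def Let_def defs)
  have two: "[l..<l + 2] = [l, l + 1]" by (simp add: upt_rec)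
  \<comment> \<open>At a cup or cap the two points lie on one arc with opposite directions, so their
    objects cancel; at a crossing the claim is \<open>crossing_mor\<close>.\<close>
  have piece: "(\<forall>f \<in> set M. valid_mor f) \<and> row_prod (map source M) = row_prod (map (obj t) [l..<l + k])
      \<and> row_prod (map target M) = row_prod (map (obj (Suc t)) [l..<l + k'])"
  proof (cases p)
    case NoPiece
    then show ?thesis by (simp add: M_def piece_eval_def Let_def k_def k'_def flip: p_def)
  next
    case (Cup e)
    have "obj t l \<otimes> obj t (l + 1) = \<one>"
      using link[of "(t, l)" "(t, l + 1)"] nth(3)[of 0] nth(3)[of 1] Cup closed(1)[of l] closed(1)[of "Suc l"]
      by (cases e) (auto simp: point_obj_def over_links_def Let_def defs)
    then show ?thesis
      using Cup closed(1)[of l] closed(1)[of "Suc l"]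
      by (simp add: M_def piece_eval_def Let_def k_def k'_def two valid_mor_def flip: l_def p_def)
  next
    case (Cap e)
    have "obj (Suc t) l \<otimes> obj (Suc t) (l + 1) = \<one>"
      using link[of "(Suc t, l)" "(Suc t, l + 1)"] nth(4)[of 0] nth(4)[of 1] Cap closed(2)[of l] closed(2)[of "Suc l"]
      by (cases e) (auto simp: point_obj_def over_links_def Let_def defs)
    then show ?thesis
      using Cap closed(2)[of l] closed(2)[of "Suc l"]
      by (simp add: M_def piece_eval_def Let_def k_def k'_def two valid_mor_def flip: l_def p_def)
  next
    case XPos
    then have X: "t \<in> crossings D" "mid (D ! t) = XPos" using t by (auto simp: crossings_def p_def)
    then have "arc_of D (t, l + 1) = arc_of D (Suc t, l)"
      using link[of "(t, l + 1)" "(Suc t, l)"] by (simp add: over_links_def Let_def l_def)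
    then have "obj t l = c (under_in_arc D t)" "obj t (Suc l) = c (over_arc D t)"
        "obj (Suc t) l = c (over_arc D t)" "obj (Suc t) (Suc l) = c (under_out_arc D t)"
      using X nth(3)[of 0] nth(3)[of 1] nth(4)[of 0] nth(4)[of 1] XPos
      by (simp_all add: k_def k'_def point_obj_def over_arc_def under_in_arc_def under_out_arc_def
        over_point_def under_in_point_def under_out_point_def flip: l_def)
    then show ?thesis
      using X XPos crossing_mor[OF X(1)] crossing_labels[OF X(1)] closed(1)[of l] closed(1)[of "Suc l"]
         closed(2)[of l] closed(2)[of "Suc l"]
      by (simp add: M_def piece_eval_def Let_def k_def k'_def two valid_mor_def flip: l_def)
  next
    case XNeg
    then have X: "t \<in> crossings D" "mid (D ! t) = XNeg" using t by (auto simp: crossings_def p_def)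
    then have "arc_of D (t, l) = arc_of D (Suc t, l + 1)"
      using link[of "(t, l)" "(Suc t, l + 1)"] by (simp add: over_links_def Let_def l_def)
    then have "obj t (Suc l) = c (under_in_arc D t)" "obj t l = c (over_arc D t)"
        "obj (Suc t) (Suc l) = c (over_arc D t)" "obj (Suc t) l = c (under_out_arc D t)"
      using X nth(3)[of 0] nth(3)[of 1] nth(4)[of 0] nth(4)[of 1] XNeg
      by (simp_all add: k_def k'_def point_obj_def over_arc_def under_in_arc_def under_out_arc_def
        over_point_def under_in_point_def under_out_point_def flip: l_def)
    then show ?thesis
      using X XNeg crossing_mor[OF X(1)] crossing_labels[OF X(1)] closed(1)[of l] closed(1)[of "Suc l"]
         closed(2)[of l] closed(2)[of "Suc l"]
      by (simp add: M_def piece_eval_def Let_def k_def k'_def two valid_mor_def flip: l_def)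
  qed
  have valid: "valid_mor f" if "f \<in> set fs" for f
    using that piece closed by (auto simp: fs_def vertical_def mor_id_def valid_mor_def)
  show "valid_mor S"
    unfolding S using valid by (rule foldr_tensor)
  have upt: "[0..<l + n + r] = [0..<l] @ [l..<l + n] @ [l + n..<l + n + r]" for n
    using upt_add_eq_append[of 0 "l + n" r] upt_add_eq_append[of 0 l n] by simp
  have sets1: "set (map source M) \<subseteq> carrier G" "set (map target M) \<subseteq> carrier G"
    using piece by (auto simp: valid_mor_def)
  have sets2: "set (map (obj t) [0..<l]) \<subseteq> carrier G" "set (map (obj t) [l..<l + k]) \<subseteq> carrier G"
    "set (map (obj t) [l + k..<l + k + r]) \<subseteq> carrier G"
    "set (map (obj (Suc t)) [0..<l]) \<subseteq> carrier G" "set (map (obj (Suc t)) [l..<l + k']) \<subseteq> carrier G"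
    "set (map (obj (Suc t)) [l + k'..<l + k' + r]) \<subseteq> carrier G"
    using closed by auto
  note sets = sets1 sets2
  have "map source fs = map (obj t) [0..<l] @ map source M @ map (obj t) [l + k..<l + k + r]"
    by (simp add: fs_def vertical_def mor_id_def)
  then show "source S = row t"
    using sets piece foldr_tensor(2)[OF valid]
    by (simp add: S row_def len upt row_prod_append del: set_map)
  \<comment> \<open>Vertical strands carry their level \<open>t\<close> label even in the target.
    \<open>left\<close> and \<open>right\<close> move it to level \<open>Suc t\<close>, where
    strands right of the piece may be renumbered.\<close>
  have "map target fs = map (obj t) [0..<l] @ map target M @ map (obj t) [l + k..<l + k + r]"
    by (simp add: fs_def vertical_def mor_id_def)
  also have "map (obj t) [0..<l] = map (obj (Suc t)) [0..<l]"
    using left by simp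
  also have "map (obj t) [l + k..<l + k + r] = map (obj (Suc t)) [l + k'..<l + k' + r]"
    using right by (rule map_upt_shift)
  finally show "target S = row (Suc t)"
    using sets piece foldr_tensor(3)[OF valid]
    by (simp add: S row_def len upt row_prod_append del: set_map)
qed

lemma evaluation_valid:
  defines "E \<equiv> evaluation G G (conj_action G) D (c, d)"
  shows "valid_mor E" "source E = c (arc_of D (top_point D))" "target E = c (arc_of D (bot_point D))"
proof -
  have ends: "obj 0 0 = c (arc_of D (top_point D))" "obj (length D) 0 = c (arc_of D (bot_point D))"
      "obj 0 0 \<in> carrier G" "obj (length D) 0 \<in> carrier G"
    using labels arc_of_arcs[OF tangle end_points(1)[OF tangle]] arc_of_arcs[OF tangle end_points(2)[OF tangle]]
    by (auto simp: point_obj_def boundary_ends[OF tangle] top_point_def bot_point_def)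
  then have rows: "row 0 = obj 0 0" "row (length D) = obj (length D) 0"
    by (simp_all add: row_def boundary_ends[OF tangle])
  \<comment> \<open>Evaluation of the first \<open>n\<close> strips, so that the induction keeps the
    source fixed while the target runs through the rows.\<close>
  define F where "F n = foldl (mor_comp G) (mor_id G (obj 0 0))
    (map (strip_eval G G (conj_action G) D (c, d)) [0..<n])" for n
  have "valid_mor (F n) \<and> source (F n) = row 0 \<and> target (F n) = row n" if "n \<le> length D" for n
    using that
  proof (induction n)
    case 0
    then show ?case using ends by (simp add: F_def mor_id_def valid_mor_def rows)
  next
    case (Suc n)
    have "F (Suc n) = mor_comp G (F n) (strip_eval G G (conj_action G) D (c, d) n)"
      by (simp add: F_def)
    moreover have "valid_mor (mor_comp G (F n) (strip_eval G G (conj_action G) D (c, d) n))"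
      using Suc strip_eval_row[of n] by (intro valid_mor_comp) simp_all
    ultimately show ?case
      using Suc strip_eval_row[of n] by (simp add: mor_comp_def)
  qed
  moreover have "E = F (length D)"
    by (simp add: E_def F_def evaluation_def)
  ultimately show "valid_mor E" "source E = c (arc_of D (top_point D))" "target E = c (arc_of D (bot_point D))"
    using rows ends by auto
qed

end

end

section \<open>Colourings and homomorphisms of the knot group\<close>

context group
begin

text \<open>The factor of the longitude at crossing \<open>t\<close>, with the sign exponent written
  out.\<close>

definition crossing_twist :: "diagram \<Rightarrow> (arc \<Rightarrow> 'a) \<Rightarrow> nat \<Rightarrow> 'a"
  where "crossing_twist D \<gamma> t = (if mid (D ! t) = XPos
    then inv \<gamma> (under_in_arc D t) \<otimes> \<gamma> (over_arc D t)
    else \<gamma> (under_in_arc D t) \<otimes> inv \<gamma> (over_arc D t))"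

definition partial_longitude :: "diagram \<Rightarrow> (arc \<Rightarrow> 'a) \<Rightarrow> nat \<Rightarrow> 'a"
  where "partial_longitude D \<gamma> k =
    row_prod (map (\<lambda>i. crossing_twist D \<gamma> (nth_under D i)) [0..<k])"

definition wirtinger_at :: "diagram \<Rightarrow> (arc \<Rightarrow> 'a) \<Rightarrow> nat \<Rightarrow> bool"
  where "wirtinger_at D \<gamma> t \<longleftrightarrow> (if mid (D ! t) = XPos
    then \<gamma> (under_in_arc D t) \<otimes> \<gamma> (over_arc D t) = \<gamma> (over_arc D t) \<otimes> \<gamma> (under_out_arc D t)
    else \<gamma> (over_arc D t) \<otimes> \<gamma> (under_in_arc D t) = \<gamma> (under_out_arc D t) \<otimes> \<gamma> (over_arc D t))"

definition wirtinger_labels :: "diagram \<Rightarrow> 'a \<Rightarrow> (arc \<Rightarrow> 'a) set"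
  where "wirtinger_labels D x = {\<gamma> \<in> arcs D \<rightarrow>\<^sub>E carrier G.
    (\<forall>t \<in> crossings D. wirtinger_at D \<gamma> t) \<and> \<gamma> (nth_arc D 0) = x}"

text \<open>The incoming part of the twist commutes with the incoming label, so conjugating by the
  twist is conjugating by the over label or its inverse: the Wirtinger relation solved for the
  outgoing label.\<close>

lemma wirtinger_at_step:
  assumes "x \<in> carrier G" "u \<in> carrier G" "\<gamma> (over_arc D t) \<in> carrier G"
    "\<gamma> (under_out_arc D t) \<in> carrier G" "\<gamma> (under_in_arc D t) = label_gen x u"
  shows "wirtinger_at D \<gamma> t \<longleftrightarrow> \<gamma> (under_out_arc D t) = label_gen x (u \<otimes> crossing_twist D \<gamma> t)"
proof -
  have eq1: "b \<otimes> a = a \<otimes> y \<longleftrightarrow> y = inv a \<otimes> b \<otimes> a" and eq2: "a \<otimes> b = y \<otimes> a \<longleftrightarrow> y = a \<otimes> b \<otimes> inv a"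
    if "a \<in> carrier G" "b \<in> carrier G" "y \<in> carrier G" for a b y
    using that inv_solve_left[of y a "b \<otimes> a"] inv_solve_right[of y "a \<otimes> b" a]
    by (simp_all add: m_assoc)
  show ?thesis
    unfolding wirtinger_at_def crossing_twist_def using assms
    by (simp add: eq1 eq2) (simp add: label_gen_def group_word_simps)
qed

text \<open>In [u^-1, x^-1] [x^-1, v^-1] the inner powers of x cancel, leaving the quotient of two
  conjugates of x; for a negative crossing x replaces x^-1.\<close>

lemma crossing_twist_in_derived:
  assumes "x \<in> carrier G" "u \<in> carrier G" "v \<in> carrier G"
    "\<gamma> (under_in_arc D t) = label_gen x u" "\<gamma> (over_arc D t) = label_gen x v"
  shows "crossing_twist D \<gamma> t \<in> derived G (carrier G)"
proof -
  have "crossing_twist D \<gamma> t = (if mid (D ! t) = XPos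
    then commutator G (inv u) (inv x) \<otimes> commutator G (inv x) (inv v)
    else commutator G (inv u) x \<otimes> commutator G x (inv v))"
    using assms by (simp add: crossing_twist_def label_gen_def commutator_def group_word_simps)
  then show ?thesis
    using assms by (simp add: commutator_in_derived subgroup.m_closed[OF derived_subgroup])
qed

context
  fixes D :: diagram and x :: 'a
  assumes string_knot: "string_knot_diagram D" and x: "x \<in> carrier G"
begin

lemma tangle: "is_tangle [Down] D [Down]"
  using string_knot by (simp add: string_knot_diagram_def)

lemma connected:
  "\<forall>p \<in> points D. \<forall>q \<in> points D. (p, q) \<in> (all_links D \<union> (all_links D)\<inverse>)\<^sup>*"
  using string_knot by (simp add: string_knot_diagram_def)

lemmas enumeration = nth_arc_last_bij[OF tangle connected]
  and under = nth_under[OF tangle connected]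
  and cross_arcs = crossing_arcs[OF tangle]

abbreviation "num_arcs \<equiv> card (arcs D)"

lemma nth_arc_in: "i < num_arcs \<Longrightarrow> nth_arc D i \<in> arcs D"
  using bij_betwE[OF enumeration(2)] by simp

lemma arcs_index:
  assumes "a \<in> arcs D"
  obtains i where "i < num_arcs" "a = nth_arc D i"
proof -
  have "a \<in> nth_arc D ` {..<num_arcs}"
    using assms bij_betw_imp_surj_on[OF enumeration(2)] by simp
  then show thesis using that by auto
qed

lemma crossing_twist_closed:
  assumes "\<gamma> \<in> arcs D \<rightarrow> carrier G" "t \<in> crossings D"
  shows "crossing_twist D \<gamma> t \<in> carrier G"
  using assms cross_arcs[OF assms(2)] by (auto simp: crossing_twist_def Pi_iff)

lemma partial_longitude_0: "partial_longitude D \<gamma> 0 = \<one>"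
  by (simp add: partial_longitude_def)

lemma partial_longitude_Suc:
  assumes "\<gamma> \<in> arcs D \<rightarrow> carrier G" "k < num_arcs - 1"
  shows "partial_longitude D \<gamma> (Suc k) =
    partial_longitude D \<gamma> k \<otimes> crossing_twist D \<gamma> (nth_under D k)"
proof -
  have "crossing_twist D \<gamma> (nth_under D i) \<in> carrier G" if "i \<le> k" for i
    using that assms under(1)[of i] by (intro crossing_twist_closed) auto
  then show ?thesis
    unfolding partial_longitude_def by (subst upt_Suc) (auto simp: row_prod_append image_subset_iff)
qed

lemma partial_longitude_closed:
  assumes "\<gamma> \<in> arcs D \<rightarrow> carrier G" "k \<le> num_arcs - 1"
  shows "partial_longitude D \<gamma> k \<in> carrier G"
  using assms(2)
proof (induction k)
  case (Suc k)
  then show ?case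
    using partial_longitude_Suc[OF assms(1)] crossing_twist_closed[OF assms(1) under(1)[of k]] by simp
qed (simp add: partial_longitude_0)

lemma wirtinger_label_gen:
  assumes \<gamma>: "\<gamma> \<in> wirtinger_labels D x" and "i < num_arcs"
  shows "\<gamma> (nth_arc D i) = label_gen x (partial_longitude D \<gamma> i)"
  using assms(2)
proof (induction i)
  case 0
  then show ?case using \<gamma> x by (simp add: wirtinger_labels_def partial_longitude_0 label_gen_def)
next
  case (Suc i)
  have \<gamma>': "\<gamma> \<in> arcs D \<rightarrow> carrier G" using \<gamma> by (auto simp: wirtinger_labels_def)
  have t: "nth_under D i \<in> crossings D" "under_in_arc D (nth_under D i) = nth_arc D i"
    using under[of i] Suc.prems by auto
  have "\<gamma> (under_out_arc D (nth_under D i)) =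
      label_gen x (partial_longitude D \<gamma> i \<otimes> crossing_twist D \<gamma> (nth_under D i))"
    using \<gamma> \<gamma>' t x cross_arcs[OF t(1)] Suc partial_longitude_closed[OF \<gamma>', of i]
    by (subst wirtinger_at_step[symmetric]) (auto simp: wirtinger_labels_def Pi_iff)
  then show ?case
    using partial_longitude_Suc[OF \<gamma>'] Suc.prems by (simp add: nth_under_def)
qed

lemma partial_longitude_in_derived:
  assumes \<gamma>: "\<gamma> \<in> wirtinger_labels D x" and "k \<le> num_arcs - 1"
  shows "partial_longitude D \<gamma> k \<in> derived G (carrier G)"
  using assms(2)
proof (induction k)
  case 0
  then show ?case by (simp add: partial_longitude_0 subgroup.one_closed[OF derived_subgroup])
next
  case (Suc k)
  have \<gamma>': "\<gamma> \<in> arcs D \<rightarrow> carrier G" using \<gamma> by (auto simp: wirtinger_labels_def)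
  have t: "nth_under D k \<in> crossings D"
    using under[of k] Suc.prems by auto
  \<comment> \<open>This is needed for the over arc as well, which may come later along the knot
    than the crossing; so the label formula is used for all arcs at once.\<close>
  have "\<exists>u \<in> carrier G. \<gamma> a = label_gen x u" if "a \<in> arcs D" for a
    using that wirtinger_label_gen[OF \<gamma>] partial_longitude_closed[OF \<gamma>']
    by (metis arcs_index less_Suc_eq_le Suc_pred' enumeration(3))
  then have "crossing_twist D \<gamma> (nth_under D k) \<in> derived G (carrier G)"
    using cross_arcs[OF t] crossing_twist_in_derived[OF x] by metis
  then show ?case
    using Suc partial_longitude_Suc[OF \<gamma>'] subgroup.m_closed[OF derived_subgroup] by simp
qed

section \<open>Homomorphisms, labellings and the longitude\<close>

lemma meridian_homs_bij:
  "bij_betw (\<lambda>f. \<lambda>a \<in> arcs D. f (wirtinger_gen D a)) (meridian_homs G x D) (wirtinger_labels D x)"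
proof -
  have relations: "respects_relations (arcs D) (wirtinger_relations D) \<gamma> \<longleftrightarrow>
      (\<forall>t \<in> crossings D. wirtinger_at D \<gamma> t)" if "\<gamma> \<in> arcs D \<rightarrow> carrier G" for \<gamma>
  proof -
    have "\<gamma> a \<in> carrier G" if "t \<in> crossings D" "a \<in> {over_arc D t, under_in_arc D t, under_out_arc D t}" for t a
      using that \<open>\<gamma> \<in> _\<close> cross_arcs by auto
    then show ?thesis
      using cross_arcs
      unfolding respects_relations_def wirtinger_relations_def wirtinger_at_def
      by (fastforce simp: Let_def split: if_splits)
  qed
  have m: "nth_arc D 0 \<in> arcs D" using nth_arc_in enumeration(3) by blast
  have "bij_betw (\<lambda>f. \<lambda>a \<in> arcs D. f (wirtinger_gen D a))
    {f \<in> hom (knot_group D) G \<inter> extensional (carrier (knot_group D)).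
      (\<lambda>a \<in> arcs D. f (wirtinger_gen D a)) (nth_arc D 0) = x}
    {\<gamma> \<in> {\<gamma> \<in> arcs D \<rightarrow>\<^sub>E carrier G. respects_relations (arcs D) (wirtinger_relations D) \<gamma>}.
      \<gamma> (nth_arc D 0) = x}"
    using presented_group_homs[of "arcs D" "wirtinger_relations D"]
    unfolding knot_group_def wirtinger_gen_def by (rule bij_betw_Collect) simp
  moreover have "{\<gamma> \<in> {\<gamma> \<in> arcs D \<rightarrow>\<^sub>E carrier G. respects_relations (arcs D) (wirtinger_relations D) \<gamma>}.
      \<gamma> (nth_arc D 0) = x} = wirtinger_labels D x"
    unfolding wirtinger_labels_def using relations by (auto simp: PiE_def)
  ultimately show ?thesis
    using m by (simp add: meridian_homs_def meridian_def del: nth_arc.simps)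
qed

lemma hom_longitude:
  assumes "f \<in> hom (knot_group D) G"
  shows "f (longitude D) = partial_longitude D (\<lambda>a \<in> arcs D. f (wirtinger_gen D a)) (num_arcs - 1)"
proof -
  interpret f: group_hom "knot_group D" G f
    using assms group_presented_group
    by (intro group_hom.intro group_hom_axioms.intro is_group) (auto simp: knot_group_def)
  have gen: "wirtinger_gen D a \<in> carrier (knot_group D)" if "a \<in> arcs D" for a
    using that by (auto simp: wirtinger_gen_def knot_group_def presented_group_simps)
  define w where "w = (\<lambda>i. let \<theta> = crossing_sign D (nth_under D i) in
        wirtinger_gen D (nth_arc D i) [^]\<^bsub>knot_group D\<^esub> (- \<theta>) \<otimes>\<^bsub>knot_group D\<^esub>
        wirtinger_gen D (over_arc D (nth_under D i)) [^]\<^bsub>knot_group D\<^esub> \<theta>)"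
  have w: "w i \<in> carrier (knot_group D)"
    "f (w i) = crossing_twist D (\<lambda>a \<in> arcs D. f (wirtinger_gen D a)) (nth_under D i)"
    if "i < num_arcs - 1" for i
    using cross_arcs[OF under(1)[OF that]] gen under(2)[OF that]
    by (auto simp: w_def Let_def crossing_sign_def crossing_twist_def f.G.int_pow_neg)
  \<comment> \<open>Arbitrary index lists suit the induction; membership in the carrier is carried
    along for multiplicativity of \<open>f\<close>.\<close>
  have "f (foldr (\<lambda>u v. u \<otimes>\<^bsub>knot_group D\<^esub> v) (map w is) \<one>\<^bsub>knot_group D\<^esub>) =
      row_prod (map (\<lambda>i. crossing_twist D (\<lambda>a \<in> arcs D. f (wirtinger_gen D a)) (nth_under D i)) is) \<and>
      foldr (\<lambda>u v. u \<otimes>\<^bsub>knot_group D\<^esub> v) (map w is) \<one>\<^bsub>knot_group D\<^esub> \<in> carrier (knot_group D)"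
    if "set is \<subseteq> {..<num_arcs - 1}" for "is"
    using that by (induction "is") (auto simp: w)
  from this[of "[0..<num_arcs - 1]"] show ?thesis
    by (simp add: longitude_def partial_longitude_def w_def atLeast0LessThan)
qed

lemma eisermann_coeff_eq:
  "eisermann_coeff G x D g = card {\<gamma> \<in> wirtinger_labels D x. partial_longitude D \<gamma> (num_arcs - 1) = g}"
proof -
  have "bij_betw (\<lambda>f. \<lambda>a \<in> arcs D. f (wirtinger_gen D a)) {f \<in> meridian_homs G x D. f (longitude D) = g}
    {\<gamma> \<in> wirtinger_labels D x. partial_longitude D \<gamma> (num_arcs - 1) = g}"
    by (rule bij_betw_Collect[OF meridian_homs_bij]) (auto simp: meridian_homs_def hom_longitude)
  then show ?thesis
    unfolding eisermann_coeff_def by (rule bij_betw_same_card)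
qed

text \<open>Guards against the convention that a sum over an infinite set, as in
  \<open>eisermann\<close>, is zero.\<close>

lemma finite_meridian_homs:
  assumes "finite (carrier G)"
  shows "finite (meridian_homs G x D)"
proof -
  have "finite (arcs D \<rightarrow>\<^sub>E carrier G)"
    using finite_arcs[OF tangle] assms by (rule finite_PiE)
  then have "finite (wirtinger_labels D x)"
    by (rule rev_finite_subset) (auto simp: wirtinger_labels_def)
  then show ?thesis
    using bij_betw_finite[OF meridian_homs_bij] by simp
qed

text \<open>The step equation at a crossing yields the Wirtinger relation through
  \<open>wirtinger_at_step\<close>; read along the enumeration it is the recursion of the partial
  longitudes, started at the top value.\<close>

lemma label_colouring:
  assumes "c \<in> arcs D \<rightarrow>\<^sub>E carrier G" "c (nth_arc D 0) = \<one>"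
    and step: "\<And>t. t \<in> crossings D \<Longrightarrow> c (under_out_arc D t) =
      c (under_in_arc D t) \<otimes> crossing_twist D (\<lambda>a \<in> arcs D. label_gen x (c a)) t"
  defines "\<gamma> \<equiv> \<lambda>a \<in> arcs D. label_gen x (c a)"
  shows "\<gamma> \<in> wirtinger_labels D x" "\<And>i. i < num_arcs \<Longrightarrow> c (nth_arc D i) = partial_longitude D \<gamma> i"
proof -
  have c: "a \<in> arcs D \<Longrightarrow> c a \<in> carrier G" for a using assms(1) by auto
  have \<gamma>: "\<gamma> \<in> arcs D \<rightarrow> carrier G" using c x by (auto simp: \<gamma>_def)
  have "wirtinger_at D \<gamma> t" if "t \<in> crossings D" for t
  proof -
    note t = cross_arcs[OF that]
    have "\<gamma> (over_arc D t) \<in> carrier G" "\<gamma> (under_out_arc D t) \<in> carrier G"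
      using \<gamma> t by auto
    moreover have "\<gamma> (under_in_arc D t) = label_gen x (c (under_in_arc D t))"
      "\<gamma> (under_out_arc D t) = label_gen x (c (under_out_arc D t))"
      using t by (simp_all add: \<gamma>_def)
    ultimately show ?thesis
      using step[OF that, folded \<gamma>_def] wirtinger_at_step[OF x c[OF t(2)]] by simp
  qed
  moreover have "\<gamma> (nth_arc D 0) = x"
    using nth_arc_in enumeration(3) assms(2) x by (auto simp: \<gamma>_def label_gen_def simp del: nth_arc.simps)
  moreover have "\<gamma> \<in> extensional (arcs D)" by (simp add: \<gamma>_def)
  ultimately show "\<gamma> \<in> wirtinger_labels D x"
    using \<gamma> by (simp add: wirtinger_labels_def PiE_def)
  show "c (nth_arc D i) = partial_longitude D \<gamma> i" if "i < num_arcs" for i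
    using that
  proof (induction i)
    case 0
    then show ?case using assms(2) by (simp add: partial_longitude_0)
  next
    case (Suc i)
    then have "i < num_arcs - 1" by simp
    then show ?case
      using Suc step[OF under(1)[of i], folded \<gamma>_def] under(2)[of i] partial_longitude_Suc[OF \<gamma>]
      by (simp add: nth_under_def)
  qed
qed

abbreviation "crossing_elements c \<equiv> \<lambda>t \<in> crossings D. if mid (D ! t) = XPos
  then psi_pair G x (c (over_arc D t)) (c (under_out_arc D t))
  else phi_pair G x (c (over_arc D t)) (c (under_out_arc D t))"

lemma colourings_iff:
  "(c, d) \<in> colourings G' G' id (psi_pair G x) (phi_pair G x) D \<one> g \<longleftrightarrow>
    c \<in> arcs D \<rightarrow>\<^sub>E derived G (carrier G) \<and> d = crossing_elements c \<and>
    c (nth_arc D 0) = \<one> \<and> c (nth_arc D (num_arcs - 1)) = g \<and>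
    (\<forall>t \<in> crossings D. c (under_out_arc D t) =
      c (under_in_arc D t) \<otimes> crossing_twist D (\<lambda>a \<in> arcs D. label_gen x (c a)) t)"
proof (cases "c \<in> arcs D \<rightarrow>\<^sub>E derived G (carrier G)")
  case True
  define X Y Z where "X t = c (over_arc D t)" and "Y t = c (under_out_arc D t)"
    and "Z t = c (under_in_arc D t)" for t
  note XYZ = X_def Y_def Z_def
  have in_derived: "X t \<in> derived G (carrier G)" "Y t \<in> derived G (carrier G)" "Z t \<in> derived G (carrier G)"
    if "t \<in> crossings D" for t
    using True cross_arcs[OF that] by (auto simp: XYZ)
  note in_carrier = in_derived[THEN derived_carrier]
  have twist: "crossing_twist D (\<lambda>a \<in> arcs D. label_gen x (c a)) t = (if mid (D ! t) = XPos
      then inv (label_gen x (Z t)) \<otimes> label_gen x (X t) else label_gen x (Z t) \<otimes> inv (label_gen x (X t)))"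
    if "t \<in> crossings D" for t
    using cross_arcs[OF that] by (simp add: crossing_twist_def XYZ)
  let ?P = "\<lambda>t. if mid (D ! t) = XPos
      then d t = psi_pair G x (X t) (Y t) \<and>
        Z t = inv\<^bsub>G'\<^esub> (id (psi_pair G x (X t) (Y t))) \<otimes>\<^bsub>G'\<^esub> X t \<otimes>\<^bsub>G'\<^esub> Y t \<otimes>\<^bsub>G'\<^esub> inv\<^bsub>G'\<^esub> X t
      else d t = phi_pair G x (X t) (Y t) \<and>
        Z t = inv\<^bsub>G'\<^esub> X t \<otimes>\<^bsub>G'\<^esub> inv\<^bsub>G'\<^esub> (id (phi_pair G x (X t) (Y t))) \<otimes>\<^bsub>G'\<^esub> Y t \<otimes>\<^bsub>G'\<^esub> X t"
  let ?Q = "\<lambda>t. Y t = Z t \<otimes> crossing_twist D (\<lambda>a \<in> arcs D. label_gen x (c a)) t"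
  have crossing: "?P t \<longleftrightarrow> d t = crossing_elements c t \<and> ?Q t"
    if t: "t \<in> crossings D" for t
    using t in_derived[OF t] pair_in_derived[OF x in_carrier(1)[OF t] in_carrier(2)[OF t]]
      pos_crossing_step[OF x in_carrier[OF t]] neg_crossing_step[OF x in_carrier[OF t]]
    by (simp add: twist commutator_group_simps flip: XYZ)
  \<comment> \<open>The component \<open>d\<close> carries no information: its values are prescribed
    by \<open>c\<close>, and \<open>pair_in_derived\<close> puts them in the right group.\<close>
  have elements: "d \<in> crossings D \<rightarrow>\<^sub>E derived G (carrier G) \<and> (\<forall>t \<in> crossings D. d t = crossing_elements c t)
      \<longleftrightarrow> d = crossing_elements c"
  proof -
    have "crossing_elements c \<in> crossings D \<rightarrow>\<^sub>E derived G (carrier G)"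
      using pair_in_derived[OF x in_carrier(1) in_carrier(2)] by (simp flip: XYZ)
    then show ?thesis
      using PiE_ext[of d "crossings D" "\<lambda>_. derived G (carrier G)" "crossing_elements c"] by blast
  qed
  have ends: "nth_arc D 0 = arc_of D (top_point D)" "nth_arc D (num_arcs - 1) = arc_of D (bot_point D)"
    using enumeration(1) by simp_all
  have "(c, d) \<in> colourings G' G' id (psi_pair G x) (phi_pair G x) D \<one> g \<longleftrightarrow>
      c \<in> arcs D \<rightarrow>\<^sub>E derived G (carrier G) \<and> d \<in> crossings D \<rightarrow>\<^sub>E derived G (carrier G) \<and>
      c (nth_arc D 0) = \<one> \<and> c (nth_arc D (num_arcs - 1)) = g \<and> (\<forall>t \<in> crossings D. ?P t)"
    unfolding colourings_def Let_def XYZ ends commutator_group_simps(1)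
    by (simp only: mem_Collect_eq prod.case)
  also have "(\<forall>t \<in> crossings D. ?P t) \<longleftrightarrow>
      (\<forall>t \<in> crossings D. d t = crossing_elements c t) \<and> (\<forall>t \<in> crossings D. ?Q t)"
    using crossing by blast
  finally show ?thesis
    using elements unfolding XYZ by blast
next
  case False
  then show ?thesis by (simp add: colourings_def commutator_group_simps)
qed

lemma colourings_bij:
  "bij_betw (\<lambda>(c, d). \<lambda>a \<in> arcs D. label_gen x (c a))
    (colourings G' G' id (psi_pair G x) (phi_pair G x) D \<one> g)
    {\<gamma> \<in> wirtinger_labels D x. partial_longitude D \<gamma> (num_arcs - 1) = g}"
  (is "bij_betw ?r ?A ?B")
  unfolding bij_betw_def
proof
  have label: "?r (c, d) \<in> wirtinger_labels D x"
    "\<And>i. i < num_arcs \<Longrightarrow> c (nth_arc D i) = partial_longitude D (?r (c, d)) i"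
    if "(c, d) \<in> ?A" for c d
  proof -
    have "c \<in> arcs D \<rightarrow>\<^sub>E carrier G"
      using that derived_carrier by (auto simp: colourings_iff PiE_iff)
    then show "?r (c, d) \<in> wirtinger_labels D x"
      "\<And>i. i < num_arcs \<Longrightarrow> c (nth_arc D i) = partial_longitude D (?r (c, d)) i"
      using that label_colouring[of c] by (auto simp: colourings_iff simp del: nth_arc.simps)
  qed
  show "inj_on ?r ?A"
  proof (rule inj_onI, clarify)
    fix c d c' d' assume *: "(c, d) \<in> ?A" "(c', d') \<in> ?A"
      "(\<lambda>a \<in> arcs D. label_gen x (c a)) = (\<lambda>a \<in> arcs D. label_gen x (c' a))"
    \<comment> \<open>On every arc both equal the partial longitude of the common labelling.\<close>
    have "c = c'"
    proof (rule extensionalityI)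
      show "c \<in> extensional (arcs D)" "c' \<in> extensional (arcs D)"
        using *(1,2) by (simp_all add: colourings_iff PiE_def)
      show "c a = c' a" if "a \<in> arcs D" for a
        using that label(2)[OF *(1)] label(2)[OF *(2)] *(3) by (auto elim!: arcs_index)
    qed
    then show "c = c' \<and> d = d'" using *(1,2) by (simp add: colourings_iff)
  qed
  show "?r ` ?A = ?B"
  proof (intro equalityI subsetI)
    fix \<gamma> assume "\<gamma> \<in> ?r ` ?A"
    then obtain c d where cd: "(c, d) \<in> ?A" "\<gamma> = ?r (c, d)" by auto
    then have "c (nth_arc D (num_arcs - 1)) = g" by (simp add: colourings_iff)
    then show "\<gamma> \<in> ?B"
      using label[OF cd(1)] cd(2) enumeration(3) by simp
  next
    fix \<gamma> assume "\<gamma> \<in> ?B"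
    then have \<gamma>: "\<gamma> \<in> wirtinger_labels D x" "partial_longitude D \<gamma> (num_arcs - 1) = g" by auto
    then have \<gamma>': "\<gamma> \<in> arcs D \<rightarrow> carrier G" "\<gamma> \<in> extensional (arcs D)"
      by (auto simp: wirtinger_labels_def PiE_def)
    \<comment> \<open>The inverse of the enumeration gives the position of an arc, hence how many
      longitude factors precede it.\<close>
    define c where "c = (\<lambda>a \<in> arcs D. partial_longitude D \<gamma> (inv_into {..<num_arcs} (nth_arc D) a))"
    have c: "c (nth_arc D i) = partial_longitude D \<gamma> i" if "i < num_arcs" for i
      using that nth_arc_in[OF that] inv_into_f_f[OF bij_betw_imp_inj_on[OF enumeration(2)], of i]
      by (simp add: c_def)
    have label: "(\<lambda>a \<in> arcs D. label_gen x (c a)) = \<gamma>"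
    proof (rule extensionalityI)
      show "(\<lambda>a \<in> arcs D. label_gen x (c a)) a = \<gamma> a" if "a \<in> arcs D" for a
        using that by (auto elim!: arcs_index simp: c wirtinger_label_gen[OF \<gamma>(1)])
    qed (use \<gamma>' in auto)
    \<comment> \<open>Colours must lie in \<open>G'\<close> and not merely in \<open>G\<close>; this
      rests on the commutator form of each longitude factor.\<close>
    have "c a \<in> derived G (carrier G)" if "a \<in> arcs D" for a
      using that by (auto elim!: arcs_index simp: c intro!: partial_longitude_in_derived[OF \<gamma>(1)])
    then have "c \<in> arcs D \<rightarrow>\<^sub>E derived G (carrier G)"
      by (auto simp: c_def)
    moreover have "c (under_out_arc D t) = c (under_in_arc D t) \<otimes> crossing_twist D \<gamma> t"
      if t: "t \<in> crossings D" for t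
    proof -
      obtain i where i: "i < num_arcs - 1" "t = nth_under D i"
        using nth_under_surj[OF tangle connected t] by blast
      then show ?thesis
        using c[of i] c[of "Suc i"] under(2)[OF i(1)] partial_longitude_Suc[OF \<gamma>'(1) i(1)]
        by (simp add: nth_under_def)
    qed
    ultimately have "(c, crossing_elements c) \<in> ?A"
      using c[of 0] c[of "num_arcs - 1"] enumeration(3) \<gamma>(2)
      by (simp add: colourings_iff label partial_longitude_0 del: nth_arc.simps)
    then show "\<gamma> \<in> ?r ` ?A" using label by force
  qed
qed

lemma colouring_evaluation:
  assumes "(c, d) \<in> colourings G' G' id (psi_pair G x) (phi_pair G x) D \<one> g"
  shows "evaluation G' G' (conj_action G') D (c, d) = Mor \<one> g g"
proof -
  interpret K: group G' by (rule group_commutator_group)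
  have c: "c \<in> arcs D \<rightarrow> carrier G'" and ends: "c (arc_of D (top_point D)) = \<one>" "c (arc_of D (bot_point D)) = g"
    using assms by (auto simp: colourings_def)
  have d: "d t \<in> carrier G'" if "t \<in> crossings D" for t
    using assms that by (auto simp: colourings_def)
  \<comment> \<open>The colouring rule cleared of inverses: the element takes the upper product to
    the lower one, as \<open>evaluation_valid\<close> expects.\<close>
  have mor: "if mid (D ! t) = XPos
      then d t \<otimes>\<^bsub>G'\<^esub> (c (under_in_arc D t) \<otimes>\<^bsub>G'\<^esub> c (over_arc D t)) = c (over_arc D t) \<otimes>\<^bsub>G'\<^esub> c (under_out_arc D t)
      else d t \<otimes>\<^bsub>G'\<^esub> (c (over_arc D t) \<otimes>\<^bsub>G'\<^esub> c (under_in_arc D t)) = c (under_out_arc D t) \<otimes>\<^bsub>G'\<^esub> c (over_arc D t)"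
    if t: "t \<in> crossings D" for t
  proof -
    have closed: "c (over_arc D t) \<in> carrier G'" "c (under_out_arc D t) \<in> carrier G'"
      "d t \<in> carrier G'"
      using c cross_arcs[OF t] d[OF t] by auto
    have "if mid (D ! t) = XPos
      then c (under_in_arc D t) = inv\<^bsub>G'\<^esub> d t \<otimes>\<^bsub>G'\<^esub> c (over_arc D t) \<otimes>\<^bsub>G'\<^esub> c (under_out_arc D t)
        \<otimes>\<^bsub>G'\<^esub> inv\<^bsub>G'\<^esub> c (over_arc D t)
      else c (under_in_arc D t) = inv\<^bsub>G'\<^esub> c (over_arc D t) \<otimes>\<^bsub>G'\<^esub> inv\<^bsub>G'\<^esub> d t
        \<otimes>\<^bsub>G'\<^esub> c (under_out_arc D t) \<otimes>\<^bsub>G'\<^esub> c (over_arc D t)"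
      using assms t by (auto simp: colourings_def Let_def split: if_splits)
    then show ?thesis
      using closed by (simp add: K.group_word_simps split: if_splits)
  qed
  note valid = K.evaluation_valid[of D c d, OF tangle c d mor]
  then show ?thesis
    unfolding K.valid_mor_def ends by (intro mor.expand) (auto simp: commutator_group_simps derived_carrier)
qed

end

end

text \<open>For infinite \<open>A\<close> both sides are empty by the conventions for
  \<open>sum\<close> and \<open>card\<close>.\<close>

lemma sum_const_mset: "(\<Sum>i \<in> A. {#m#}) = replicate_mset (card A) m"
  by (induction A rule: infinite_finite_induct) auto

theorem theorem4p11:
  fixes G :: "('a, 'b) monoid_scheme" and x :: 'a
  assumes "group G" and "finite (carrier G)" and "x \<in> carrier G"
  shows "(\<forall>L \<in> carrier (commutator_group G). \<forall>M \<in> carrier (commutator_group G).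
      phi_pair G x L M =
        M \<otimes>\<^bsub>G\<^esub> inv\<^bsub>G\<^esub> x \<otimes>\<^bsub>G\<^esub> L \<otimes>\<^bsub>G\<^esub> inv\<^bsub>G\<^esub> M \<otimes>\<^bsub>G\<^esub> x \<otimes>\<^bsub>G\<^esub> inv\<^bsub>G\<^esub> L \<and>
      psi_pair G x L M =
        L \<otimes>\<^bsub>G\<^esub> M \<otimes>\<^bsub>G\<^esub> inv\<^bsub>G\<^esub> L \<otimes>\<^bsub>G\<^esub> inv\<^bsub>G\<^esub> L \<otimes>\<^bsub>G\<^esub> x \<otimes>\<^bsub>G\<^esub> L \<otimes>\<^bsub>G\<^esub> inv\<^bsub>G\<^esub> M \<otimes>\<^bsub>G\<^esub> inv\<^bsub>G\<^esub> x) \<and>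
    unframed_reidemeister_pair (commutator_group G) (commutator_group G) id
      (conj_action (commutator_group G)) (psi_pair G x) (phi_pair G x) \<and>
    (\<forall>D g. string_knot_diagram D \<longrightarrow> g \<in> carrier (commutator_group G) \<longrightarrow>
      mor_set (commutator_group G) (commutator_group G) id \<one>\<^bsub>commutator_group G\<^esub> g =
        {Mor \<one>\<^bsub>commutator_group G\<^esub> g g} \<and>
      state_sum (commutator_group G) (commutator_group G) id (conj_action (commutator_group G))
          (psi_pair G x) (phi_pair G x) D \<one>\<^bsub>commutator_group G\<^esub> g =
        replicate_mset (eisermann_coeff G x D g) (Mor \<one>\<^bsub>commutator_group G\<^esub> g g) \<and>
      count (eisermann G x D) g = eisermann_coeff G x D g)"
proof -
  interpret group G by fact
  let ?K = "commutator_group G"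
  have "mor_set ?K ?K id \<one>\<^bsub>?K\<^esub> g = {Mor \<one>\<^bsub>?K\<^esub> g g} \<and>
      state_sum ?K ?K id (conj_action ?K) (psi_pair G x) (phi_pair G x) D \<one>\<^bsub>?K\<^esub> g =
        replicate_mset (eisermann_coeff G x D g) (Mor \<one>\<^bsub>?K\<^esub> g g) \<and>
      count (eisermann G x D) g = eisermann_coeff G x D g"
    if D: "string_knot_diagram D" and g: "g \<in> carrier ?K" for D g
  proof (intro conjI)
    show "mor_set ?K ?K id \<one>\<^bsub>?K\<^esub> g = {Mor \<one>\<^bsub>?K\<^esub> g g}"
      using g by (auto simp: mor_set_def commutator_group_simps derived_carrier
        subgroup.one_closed[OF derived_subgroup])
    let ?A = "colourings ?K ?K id (psi_pair G x) (phi_pair G x) D \<one>\<^bsub>G\<^esub> g"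
    have "state_sum ?K ?K id (conj_action ?K) (psi_pair G x) (phi_pair G x) D \<one>\<^bsub>G\<^esub> g =
        (\<Sum>F \<in> ?A. {#Mor \<one>\<^bsub>G\<^esub> g g#})"
      unfolding state_sum_def
    proof (rule sum.cong)
      fix F assume "F \<in> ?A"
      then show "{#evaluation ?K ?K (conj_action ?K) D F#} = {#Mor \<one>\<^bsub>G\<^esub> g g#}"
        using colouring_evaluation[OF D assms(3), of "fst F" "snd F" g] by simp
    qed simp
    also have "\<dots> = replicate_mset (eisermann_coeff G x D g) (Mor \<one>\<^bsub>G\<^esub> g g)"
      using bij_betw_same_card[OF colourings_bij[OF D assms(3)]] eisermann_coeff_eq[OF D assms(3)]
      by (simp add: sum_const_mset)
    finally show "state_sum ?K ?K id (conj_action ?K) (psi_pair G x) (phi_pair G x) D \<one>\<^bsub>?K\<^esub> g =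
        replicate_mset (eisermann_coeff G x D g) (Mor \<one>\<^bsub>?K\<^esub> g g)"
      by (simp add: commutator_group_simps)
    \<comment> \<open>Finiteness of \<open>G\<close> enters here: it makes the sum over
      homomorphisms a genuine finite sum.\<close>
    show "count (eisermann G x D) g = eisermann_coeff G x D g"
      using finite_meridian_homs[OF D assms(3,2)]
      by (simp add: eisermann_def eisermann_coeff_def count_sum sum.If_cases Int_def)
  qed
  then show ?thesis
    using assms(3) unframed_reidemeister_pair_commutator_group
    by (simp add: commutator_group_simps(1) phi_pair_word psi_pair_word derived_carrier)
qed

end
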